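(* Let $R$ be a ring. If $R$ is generalized $\sqrt{J}$-fine, then the full matrix ring $M_n(R)$ is generalized $\sqrt{J}$-fine for every positive integer $n$.
   Context: Rings are associative with identity, not necessarily commutative. For a ring $R$, $U(R)$ is the group of units, $J(R)$ the Jacobson radical, and $\sqrt{J(R)}=\{x\in R : x^m\in J(R)\text{ for some } m\ge 1\}$ (in general only a subset of $R$). A ring $R$ is called generalized $\sqrt{J}$-fine if every $r\in R\setminus J(R)$ can be written as $r=u+a$ with $u\in U(R)$ and $a\in\sqrt{J(R)}$. *)

theory Defs
  imports "HOL-Algebra.Ideal" "Jordan_Normal_Form.Matrix"
begin

text \<open>Rings are records in the locale \<^locale>\<open>ring\<close>: associative with identity, not necessarily
  commutative, the zero ring included.\<close>

section \<open>The Jacobson radical\<close>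

locale left_ideal = additive_subgroup I R + ring R for I and R (structure) +
  assumes I_l_closed: "\<lbrakk>a \<in> I; x \<in> carrier R\<rbrakk> \<Longrightarrow> x \<otimes> a \<in> I"

locale maximal_left_ideal = left_ideal +
  assumes I_notcarr: "carrier R \<noteq> I"
    and I_maximal: "\<lbrakk>left_ideal J R; I \<subseteq> J; J \<subseteq> carrier R\<rbrakk> \<Longrightarrow> J = I \<or> J = carrier R"

text \<open>The intersection is taken inside the carrier, so that the radical of the zero ring, which has
  no maximal left ideals, is the whole ring.\<close>

definition jacobson_radical :: "('a, 'm) ring_scheme \<Rightarrow> 'a set" where
  "jacobson_radical R = {x \<in> carrier R. \<forall>I. maximal_left_ideal I R \<longrightarrow> x \<in> I}"

definition sqrt_jacobson :: "('a, 'm) ring_scheme \<Rightarrow> 'a set" where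
  "sqrt_jacobson R =
    {x \<in> carrier R. \<exists>m::nat. m \<ge> 1 \<and> x [^]\<^bsub>R\<^esub> m \<in> jacobson_radical R}"

definition generalized_sqrtJ_fine :: "('a, 'm) ring_scheme \<Rightarrow> bool" where
  "generalized_sqrtJ_fine R \<longleftrightarrow>
    (\<forall>r \<in> carrier R - jacobson_radical R.
      \<exists>u \<in> Units R. \<exists>a \<in> sqrt_jacobson R. r = u \<oplus>\<^bsub>R\<^esub> a)"

section \<open>The full matrix ring\<close>

text \<open>The arithmetic on \<^typ>\<open>'a mat\<close> in the library refers to type class operations on the
  entries; here the entries come from the ring record \<open>R\<close>, and only the carrier type is reused.\<close>

definition matrix_ring_over :: "nat \<Rightarrow> ('a, 'm) ring_scheme \<Rightarrow> 'a mat ring" where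
  "matrix_ring_over n R =
    \<lparr> carrier = {A \<in> carrier_mat n n. \<forall>i<n. \<forall>j<n. A $$ (i, j) \<in> carrier R},
      monoid.mult = (\<lambda>A B. mat n n (\<lambda>(i, j). \<Oplus>\<^bsub>R\<^esub>k\<in>{..<n}. A $$ (i, k) \<otimes>\<^bsub>R\<^esub> B $$ (k, j))),
      one = mat n n (\<lambda>(i, j). if i = j then \<one>\<^bsub>R\<^esub> else \<zero>\<^bsub>R\<^esub>),
      zero = mat n n (\<lambda>(i, j). \<zero>\<^bsub>R\<^esub>),
      add = (\<lambda>A B. mat n n (\<lambda>(i, j). A $$ (i, j) \<oplus>\<^bsub>R\<^esub> B $$ (i, j))) \<rparr>"

lemma matrix_ring_over_simps [simp]:
  "A \<in> carrier (matrix_ring_over n R) \<longleftrightarrow>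
    dim_row A = n \<and> dim_col A = n \<and> (\<forall>i<n. \<forall>j<n. A $$ (i, j) \<in> carrier R)"
  "A \<otimes>\<^bsub>matrix_ring_over n R\<^esub> B =
    mat n n (\<lambda>(i, j). \<Oplus>\<^bsub>R\<^esub>k\<in>{..<n}. A $$ (i, k) \<otimes>\<^bsub>R\<^esub> B $$ (k, j))"
  "\<one>\<^bsub>matrix_ring_over n R\<^esub> = mat n n (\<lambda>(i, j). if i = j then \<one>\<^bsub>R\<^esub> else \<zero>\<^bsub>R\<^esub>)"
  "\<zero>\<^bsub>matrix_ring_over n R\<^esub> = mat n n (\<lambda>(i, j). \<zero>\<^bsub>R\<^esub>)"
  "A \<oplus>\<^bsub>matrix_ring_over n R\<^esub> B = mat n n (\<lambda>(i, j). A $$ (i, j) \<oplus>\<^bsub>R\<^esub> B $$ (i, j))"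
  unfolding matrix_ring_over_def monoid.simps partial_object.simps ring.simps carrier_mat_def
    mem_Collect_eq conj_assoc
  by (rule refl)+

context ring
begin

lemma finsum_swap:
  assumes "finite A" "finite B" "\<And>i j. i \<in> A \<Longrightarrow> j \<in> B \<Longrightarrow> f i j \<in> carrier R"
  shows "(\<Oplus>i\<in>A. \<Oplus>j\<in>B. f i j) = (\<Oplus>j\<in>B. \<Oplus>i\<in>A. f i j)"
  using assms(1,3)
proof (induction A rule: finite_induct)
  case empty
  then show ?case by simp
next
  case (insert x F)
  have "(\<Oplus>j\<in>B. \<Oplus>i\<in>insert x F. f i j) = (\<Oplus>j\<in>B. f x j \<oplus> (\<Oplus>i\<in>F. f i j))"
    using insert by (intro finsum_cong') (auto intro!: finsum_insert finsum_closed a_closed)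
  also have "\<dots> = (\<Oplus>j\<in>B. f x j) \<oplus> (\<Oplus>j\<in>B. \<Oplus>i\<in>F. f i j)"
    using insert by (intro finsum_addf) (auto intro!: finsum_closed)
  also have "\<dots> = (\<Oplus>i\<in>insert x F. \<Oplus>j\<in>B. f i j)"
    using insert by (subst finsum_insert) (auto intro!: finsum_closed)
  finally show ?case by simp
qed

lemma matrix_ring_over_is_ring: "ring (matrix_ring_over n R)"
proof (rule ringI)
  let ?M = "matrix_ring_over n R"
  show "abelian_group ?M"
  proof (rule abelian_groupI)
    fix A assume A: "A \<in> carrier ?M"
    then show "\<exists>B\<in>carrier ?M. B \<oplus>\<^bsub>?M\<^esub> A = \<zero>\<^bsub>?M\<^esub>"
      by (intro bexI[of _ "mat n n (\<lambda>(i, j). \<ominus> (A $$ (i, j)))"] eq_matI) (simp_all add: l_neg)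
  next
    fix A B assume "A \<in> carrier ?M" "B \<in> carrier ?M"
    then show "A \<oplus>\<^bsub>?M\<^esub> B = B \<oplus>\<^bsub>?M\<^esub> A"
      by (intro eq_matI) (simp_all add: a_comm)
  next
    fix A B C assume "A \<in> carrier ?M" "B \<in> carrier ?M" "C \<in> carrier ?M"
    then show "A \<oplus>\<^bsub>?M\<^esub> B \<oplus>\<^bsub>?M\<^esub> C = A \<oplus>\<^bsub>?M\<^esub> (B \<oplus>\<^bsub>?M\<^esub> C)"
      by (intro eq_matI) (simp_all add: a_assoc)
  next
    fix A assume "A \<in> carrier ?M"
    then show "\<zero>\<^bsub>?M\<^esub> \<oplus>\<^bsub>?M\<^esub> A = A"
      by (intro eq_matI) simp_all
  qed simp_all
  show "monoid ?M"
  proof (rule monoidI)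
    fix A B assume "A \<in> carrier ?M" "B \<in> carrier ?M"
    then show "A \<otimes>\<^bsub>?M\<^esub> B \<in> carrier ?M"
      by (auto intro!: finsum_closed)
  next
    show "\<one>\<^bsub>?M\<^esub> \<in> carrier ?M"
      by simp
  next
    fix A B C assume A: "A \<in> carrier ?M" and B: "B \<in> carrier ?M" and C: "C \<in> carrier ?M"
    show "A \<otimes>\<^bsub>?M\<^esub> B \<otimes>\<^bsub>?M\<^esub> C = A \<otimes>\<^bsub>?M\<^esub> (B \<otimes>\<^bsub>?M\<^esub> C)" (is "?L = ?R")
    proof (rule eq_matI)
      fix i j assume "i < dim_row ?R" "j < dim_col ?R"
      then have ij: "i < n" "j < n" by simp_all
      have "?L $$ (i, j) = (\<Oplus>k\<in>{..<n}. (\<Oplus>l\<in>{..<n}. A $$ (i, l) \<otimes> B $$ (l, k)) \<otimes> C $$ (k, j))"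
        using A B C ij by (simp, intro finsum_cong') (auto intro!: finsum_closed)
      also have "\<dots> = (\<Oplus>k\<in>{..<n}. \<Oplus>l\<in>{..<n}. A $$ (i, l) \<otimes> B $$ (l, k) \<otimes> C $$ (k, j))"
        using A B C ij by (intro finsum_cong' finsum_ldistr) (auto intro!: finsum_closed)
      also have "\<dots> = (\<Oplus>l\<in>{..<n}. \<Oplus>k\<in>{..<n}. A $$ (i, l) \<otimes> B $$ (l, k) \<otimes> C $$ (k, j))"
        using A B C ij by (intro finsum_swap) auto
      also have "\<dots> = (\<Oplus>l\<in>{..<n}. \<Oplus>k\<in>{..<n}. A $$ (i, l) \<otimes> (B $$ (l, k) \<otimes> C $$ (k, j)))"
        using A B C ij by (intro finsum_cong' m_assoc) (auto intro!: finsum_closed)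
      also have "\<dots> = (\<Oplus>l\<in>{..<n}. A $$ (i, l) \<otimes> (\<Oplus>k\<in>{..<n}. B $$ (l, k) \<otimes> C $$ (k, j)))"
        using A B C ij by (intro finsum_cong' finsum_rdistr[symmetric]) (auto intro!: finsum_closed)
      also have "\<dots> = ?R $$ (i, j)"
        using A B C ij by (simp, intro finsum_cong') (auto intro!: finsum_closed)
      finally show "?L $$ (i, j) = ?R $$ (i, j)" .
    qed simp_all
  next
    fix A assume A: "A \<in> carrier ?M"
    show "\<one>\<^bsub>?M\<^esub> \<otimes>\<^bsub>?M\<^esub> A = A"
    proof (rule eq_matI)
      fix i j assume "i < dim_row A" "j < dim_col A"
      with A have ij: "i < n" "j < n" by simp_all
      have "(\<one>\<^bsub>?M\<^esub> \<otimes>\<^bsub>?M\<^esub> A) $$ (i, j) = (\<Oplus>k\<in>{..<n}. if i = k then A $$ (k, j) else \<zero>)"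
        using A ij by (simp, intro finsum_cong') auto
      also have "\<dots> = A $$ (i, j)"
        using A ij finsum_singleton[of i "{..<n}" "\<lambda>k. A $$ (k, j)"] by auto
      finally show "(\<one>\<^bsub>?M\<^esub> \<otimes>\<^bsub>?M\<^esub> A) $$ (i, j) = A $$ (i, j)" .
    qed (use A in simp_all)
    show "A \<otimes>\<^bsub>?M\<^esub> \<one>\<^bsub>?M\<^esub> = A"
    proof (rule eq_matI)
      fix i j assume "i < dim_row A" "j < dim_col A"
      with A have ij: "i < n" "j < n" by simp_all
      have "(A \<otimes>\<^bsub>?M\<^esub> \<one>\<^bsub>?M\<^esub>) $$ (i, j) = (\<Oplus>k\<in>{..<n}. if j = k then A $$ (i, k) else \<zero>)"
        using A ij by (simp, intro finsum_cong') auto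
      also have "\<dots> = A $$ (i, j)"
        using A ij finsum_singleton[of j "{..<n}" "\<lambda>k. A $$ (i, k)"] by auto
      finally show "(A \<otimes>\<^bsub>?M\<^esub> \<one>\<^bsub>?M\<^esub>) $$ (i, j) = A $$ (i, j)" .
    qed (use A in simp_all)
  qed
  fix A B C assume ABC: "A \<in> carrier ?M" "B \<in> carrier ?M" "C \<in> carrier ?M"
  show "(A \<oplus>\<^bsub>?M\<^esub> B) \<otimes>\<^bsub>?M\<^esub> C = A \<otimes>\<^bsub>?M\<^esub> C \<oplus>\<^bsub>?M\<^esub> B \<otimes>\<^bsub>?M\<^esub> C" (is "?L = ?R")
  proof (rule eq_matI)
    fix i j assume "i < dim_row ?R" "j < dim_col ?R"
    then have ij: "i < n" "j < n" by simp_all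
    have "?L $$ (i, j) =
        (\<Oplus>k\<in>{..<n}. A $$ (i, k) \<otimes> C $$ (k, j) \<oplus> B $$ (i, k) \<otimes> C $$ (k, j))"
      using ABC ij by (simp del: finsum_addf, intro finsum_cong') (auto simp: l_distr)
    also have "\<dots> = ?R $$ (i, j)"
      using ABC ij by (subst finsum_addf) auto
    finally show "?L $$ (i, j) = ?R $$ (i, j)" .
  qed simp_all
  show "C \<otimes>\<^bsub>?M\<^esub> (A \<oplus>\<^bsub>?M\<^esub> B) = C \<otimes>\<^bsub>?M\<^esub> A \<oplus>\<^bsub>?M\<^esub> C \<otimes>\<^bsub>?M\<^esub> B" (is "?L = ?R")
  proof (rule eq_matI)
    fix i j assume "i < dim_row ?R" "j < dim_col ?R"
    then have ij: "i < n" "j < n" by simp_all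
    have "?L $$ (i, j) =
        (\<Oplus>k\<in>{..<n}. C $$ (i, k) \<otimes> A $$ (k, j) \<oplus> C $$ (i, k) \<otimes> B $$ (k, j))"
      using ABC ij by (simp del: finsum_addf, intro finsum_cong') (auto simp: r_distr)
    also have "\<dots> = ?R $$ (i, j)"
      using ABC ij by (subst finsum_addf) auto
    finally show "?L $$ (i, j) = ?R $$ (i, j)" .
  qed simp_all
qed

end

end

theory Submission
  imports Defs
begin

text \<open>Let \<open>J\<close> be the radical of \<open>R\<close>. Matrices over \<open>J\<close> lie in the radical of the matrix ring, so it
  suffices to decompose a matrix with an entry outside \<open>J\<close>, with the second summand nilpotent modulo
  \<open>J\<close>. This goes by induction on the size. Write the matrix in blocks with rows \<open>(a, b)\<close> and \<open>(c, d)\<close>;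
  after conjugation by an elementary matrix \<open>a\<close> is not over \<open>J\<close>, so \<open>a = u + t\<close> with \<open>u\<close> a unit and \<open>t\<close>
  nilpotent modulo \<open>J\<close>. If also \<open>d - (c - x) u\<inverse> (b - y) = v + s\<close>, then the matrix is the sum of the unit
  with rows \<open>(u, b - y)\<close> and \<open>(c - x, v + (c - x) u\<inverse> (b - y))\<close> and of \<open>(t, y)\<close>, \<open>(x, s)\<close>, which is
  nilpotent modulo \<open>J\<close> when \<open>x = 0\<close> or \<open>y = 0\<close>. One of \<open>x\<close>, \<open>y\<close> is used to move the Schur complement
  out of \<open>J\<close>. Blocks are handled as Peirce corners \<open>e S f\<close> of diagonal idempotents.\<close>

section \<open>The Jacobson radical as a two-sided ideal\<close>

text \<open>The sums \<open>i \<oplus> s \<otimes> z\<close> form a left ideal that contains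
  \<open>I\<close> and the outside element \<open>z\<close>, so maximality makes it the whole
  ring.\<close>

lemma (in maximal_left_ideal) decompose:
  assumes z: "z \<in> carrier R" "z \<notin> I" and w: "w \<in> carrier R"
  obtains i s where "i \<in> I" "s \<in> carrier R" "w = i \<oplus> s \<otimes> z"
proof -
  define P where "P = {i \<oplus> s \<otimes> z | i s. i \<in> I \<and> s \<in> carrier R}"
  have P: "P \<subseteq> carrier R"
    using z a_subset by (auto simp: P_def)
  have "left_ideal P R"
  proof (intro left_ideal.intro left_ideal_axioms.intro additive_subgroup.intro ring_axioms
      add.subgroupI P)
    have "\<zero> \<oplus> \<zero> \<otimes> z \<in> P"
      unfolding P_def using additive_subgroup.zero_closed[OF additive_subgroup_axioms] by blast
    then show "P \<noteq> {}" by blast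
  next
    fix p assume "p \<in> P"
    then obtain i s where p: "i \<in> I" "s \<in> carrier R" "p = i \<oplus> s \<otimes> z"
      by (auto simp: P_def)
    then have "\<ominus> p = \<ominus> i \<oplus> (\<ominus> s) \<otimes> z"
      using z a_subset by (simp add: minus_add l_minus subset_iff)
    with p show "\<ominus> p \<in> P"
      unfolding P_def by blast
  next
    fix p q assume "p \<in> P" "q \<in> P"
    then obtain i s i' s' where p: "i \<in> I" "s \<in> carrier R" "p = i \<oplus> s \<otimes> z"
      "i' \<in> I" "s' \<in> carrier R" "q = i' \<oplus> s' \<otimes> z"
      by (auto simp: P_def)
    then have "i \<in> carrier R" "i' \<in> carrier R" using a_subset by auto
    with p z have "p \<oplus> q = (i \<oplus> i') \<oplus> (s \<oplus> s') \<otimes> z" by algebra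
    with p show "p \<oplus> q \<in> P"
      unfolding P_def by blast
  next
    fix p x assume "p \<in> P" and x: "x \<in> carrier R"
    then obtain i s where p: "i \<in> I" "s \<in> carrier R" "p = i \<oplus> s \<otimes> z"
      by (auto simp: P_def)
    then have "i \<in> carrier R" using a_subset by auto
    with p z x have "x \<otimes> p = x \<otimes> i \<oplus> (x \<otimes> s) \<otimes> z" by algebra
    with p x I_l_closed show "x \<otimes> p \<in> P"
      unfolding P_def by blast
  qed
  moreover have "I \<subseteq> P"
  proof
    fix i assume i: "i \<in> I"
    then have "i = i \<oplus> \<zero> \<otimes> z" using z a_subset by (simp add: subset_iff)
    with i show "i \<in> P" unfolding P_def by blast
  qed
  moreover have "z \<in> P"
  proof -
    have "z = \<zero> \<oplus> \<one> \<otimes> z" using z by simp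
    then show ?thesis unfolding P_def using additive_subgroup.zero_closed[OF additive_subgroup_axioms] by blast
  qed
  ultimately have "P = carrier R"
    using I_maximal[of P] P z by blast
  with w that show thesis unfolding P_def by blast
qed

text \<open>The hypotheses on \<open>t\<close> make the preimage of a maximal left ideal of \<open>S\<close> under \<open>\<phi>\<close> either
  maximal or everything, so Zorn's lemma is not needed.\<close>

lemma jacobson_radical_map:
  assumes "ring R" "ring S"
    and cl: "\<And>r. r \<in> carrier R \<Longrightarrow> \<phi> r \<in> carrier S"
    and add: "\<And>r s. r \<in> carrier R \<Longrightarrow> s \<in> carrier R \<Longrightarrow> \<phi> (r \<oplus>\<^bsub>R\<^esub> s) = \<phi> r \<oplus>\<^bsub>S\<^esub> \<phi> s"
    and left: "\<And>r s. r \<in> carrier R \<Longrightarrow> s \<in> carrier R \<Longrightarrow>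
        \<exists>s'\<in>carrier S. \<phi> (s \<otimes>\<^bsub>R\<^esub> r) = s' \<otimes>\<^bsub>S\<^esub> \<phi> r"
    and t: "t \<in> carrier S" "t \<otimes>\<^bsub>S\<^esub> \<phi> \<one>\<^bsub>R\<^esub> = \<phi> \<one>\<^bsub>R\<^esub>"
    and right: "\<And>r s. r \<in> carrier R \<Longrightarrow> s \<in> carrier S \<Longrightarrow>
        \<exists>s'\<in>carrier R. t \<otimes>\<^bsub>S\<^esub> (s \<otimes>\<^bsub>S\<^esub> \<phi> r) = \<phi> (s' \<otimes>\<^bsub>R\<^esub> r)"
    and x: "x \<in> jacobson_radical R"
  shows "\<phi> x \<in> jacobson_radical S"
proof -
  interpret R: ring R by fact
  interpret S: ring S by fact
  have zero: "\<phi> \<zero>\<^bsub>R\<^esub> = \<zero>\<^bsub>S\<^esub>"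
    using add[of "\<zero>\<^bsub>R\<^esub>" "\<zero>\<^bsub>R\<^esub>"] cl[of "\<zero>\<^bsub>R\<^esub>"] S.add.l_cancel_one'[of "\<phi> \<zero>\<^bsub>R\<^esub>" "\<phi> \<zero>\<^bsub>R\<^esub>"] by simp
  have neg: "\<phi> (\<ominus>\<^bsub>R\<^esub> r) = \<ominus>\<^bsub>S\<^esub> \<phi> r" if "r \<in> carrier R" for r
    using that add[of "\<ominus>\<^bsub>R\<^esub> r" r] cl zero by (simp add: R.l_neg S.minus_equality)
  have xR: "x \<in> carrier R"
    using x by (simp add: jacobson_radical_def)
  have "\<phi> x \<in> I" if I: "maximal_left_ideal I S" for I
  proof -
    interpret I: maximal_left_ideal I S by fact
    \<comment> \<open>\<open>L\<close> is the preimage of \<open>I\<close>. If it is everything,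
      \<open>x\<close> lies in it trivially; otherwise it turns out to be maximal and contains
      \<open>x\<close> because \<open>x\<close> is in the radical.\<close>
    define L where "L = {r \<in> carrier R. \<phi> r \<in> I}"
    have LI: "left_ideal L R"
    proof (intro left_ideal.intro left_ideal_axioms.intro additive_subgroup.intro R.ring_axioms
        R.add.subgroupI)
      show "L \<noteq> {}" using zero I.zero_closed by (auto simp: L_def)
    next
      fix p r assume pr: "p \<in> L" "r \<in> carrier R"
      then obtain s' where "s' \<in> carrier S" "\<phi> (r \<otimes>\<^bsub>R\<^esub> p) = s' \<otimes>\<^bsub>S\<^esub> \<phi> p"
        using left by (auto simp: L_def)
      with pr show "r \<otimes>\<^bsub>R\<^esub> p \<in> L" using I.I_l_closed by (auto simp: L_def)
    qed (auto simp: L_def neg add)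
    show ?thesis
    proof (cases "L = carrier R")
      case True
      with xR have "x \<in> L" by simp
      then show ?thesis by (simp add: L_def)
    next
      case False
      have "maximal_left_ideal L R"
      proof (intro maximal_left_ideal.intro LI maximal_left_ideal_axioms.intro)
        show "carrier R \<noteq> L" using False by simp
      next
        fix P assume P: "left_ideal P R" "L \<subseteq> P" "P \<subseteq> carrier R"
        interpret P: left_ideal P R by fact
        show "P = L \<or> P = carrier R"
        proof (rule disjCI)
          assume "P \<noteq> carrier R"
          show "P = L"
          proof (rule ccontr)
            assume "P \<noteq> L"
            with P obtain r where r: "r \<in> P" "r \<notin> L" by blast
            then have rR: "r \<in> carrier R" using P by blast
            with r have "\<phi> r \<notin> I" by (simp add: L_def)
            then obtain i s where i: "i \<in> I" and s: "s \<in> carrier S"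
              and eq: "\<phi> \<one>\<^bsub>R\<^esub> = i \<oplus>\<^bsub>S\<^esub> s \<otimes>\<^bsub>S\<^esub> \<phi> r"
              using I.decompose[of "\<phi> r" "\<phi> \<one>\<^bsub>R\<^esub>"] cl rR by blast
            obtain s' where s': "s' \<in> carrier R" "t \<otimes>\<^bsub>S\<^esub> (s \<otimes>\<^bsub>S\<^esub> \<phi> r) = \<phi> (s' \<otimes>\<^bsub>R\<^esub> r)"
              using right rR s by blast
            have iS: "i \<in> carrier S" using i by (rule I.a_Hcarr)
            \<comment> \<open>Multiplication by \<open>t\<close> fixes the image of the identity and
              turns \<open>s \<otimes> \<phi> r\<close> into the image of
              \<open>s' \<otimes> r\<close>. Hence the identity minus \<open>s' \<otimes> r\<close>
              is mapped into \<open>I\<close>, so it lies in \<open>L\<close> and thus in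
              \<open>P\<close>; as \<open>s' \<otimes> r\<close> is in \<open>P\<close> too,
              \<open>P\<close> contains the identity.\<close>
            have "\<phi> \<one>\<^bsub>R\<^esub> = t \<otimes>\<^bsub>S\<^esub> i \<oplus>\<^bsub>S\<^esub> \<phi> (s' \<otimes>\<^bsub>R\<^esub> r)"
              using t eq s s' iS rR cl by (metis S.m_closed S.r_distr)
            then have "\<phi> (\<one>\<^bsub>R\<^esub> \<ominus>\<^bsub>R\<^esub> s' \<otimes>\<^bsub>R\<^esub> r) = t \<otimes>\<^bsub>S\<^esub> i"
              using t(1) iS s' rR cl
              by (simp add: R.minus_eq add neg S.a_assoc S.r_neg)
            then have "\<one>\<^bsub>R\<^esub> \<ominus>\<^bsub>R\<^esub> s' \<otimes>\<^bsub>R\<^esub> r \<in> P"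
              using I.I_l_closed[OF i t(1)] s' rR P(2) by (auto simp: L_def)
            moreover have "s' \<otimes>\<^bsub>R\<^esub> r \<in> P"
              using P.I_l_closed r s' by blast
            ultimately have "(\<one>\<^bsub>R\<^esub> \<ominus>\<^bsub>R\<^esub> s' \<otimes>\<^bsub>R\<^esub> r) \<oplus>\<^bsub>R\<^esub> s' \<otimes>\<^bsub>R\<^esub> r \<in> P"
              by (rule P.a_closed)
            then have "\<one>\<^bsub>R\<^esub> \<in> P"
              using s' rR by (simp add: R.minus_eq R.a_assoc R.l_neg)
            then have "carrier R \<subseteq> P"
              using P.I_l_closed by (metis R.r_one subsetI)
            with P \<open>P \<noteq> carrier R\<close> show False by blast
          qed
        qed
      qed
      with x show ?thesis by (auto simp: jacobson_radical_def L_def)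
    qed
  qed
  with xR cl show ?thesis by (auto simp: jacobson_radical_def)
qed

text \<open>An intersection of left ideals is a left ideal. For closure on the right, multiplication
  by \<open>x\<close> from the right is a left module map, so \<open>jacobson_radical_map\<close>
  applies with \<open>t\<close> the identity.\<close>

lemma (in ring) jacobson_radical_ideal: "ideal (jacobson_radical R) R"
proof (rule idealI)
  have sub: "additive_subgroup I R" if "maximal_left_ideal I R" for I
    using that by (simp add: maximal_left_ideal_def left_ideal_def)
  show "ring R" by (rule ring_axioms)
  show "subgroup (jacobson_radical R) (add_monoid R)"
  proof (rule add.subgroupI)
    show "jacobson_radical R \<noteq> {}"
      using additive_subgroup.zero_closed[OF sub] by (auto simp: jacobson_radical_def)
  qed (use additive_subgroup.a_closed[OF sub] additive_subgroup.a_inv_closed[OF sub] in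
      \<open>auto simp: jacobson_radical_def\<close>)
next
  fix a x assume "a \<in> jacobson_radical R" "x \<in> carrier R"
  then show "x \<otimes> a \<in> jacobson_radical R"
    by (auto simp: jacobson_radical_def maximal_left_ideal_def intro: left_ideal.I_l_closed)
next
  fix a x assume a: "a \<in> jacobson_radical R" and x: "x \<in> carrier R"
  show "a \<otimes> x \<in> jacobson_radical R"
    by (rule jacobson_radical_map[OF ring_axioms ring_axioms _ _ _ one_closed _ _ a])
      (use x in \<open>auto simp: l_distr m_assoc\<close>)
qed

section \<open>Peirce corners\<close>

context ring
begin

text \<open>For idempotents this is the Peirce component \<open>e R f\<close>, encoded by its
  absorption equations so that they are available directly from membership.\<close>

definition corner :: "'a \<Rightarrow> 'a \<Rightarrow> 'a set" where
  "corner e f = {x \<in> carrier R. e \<otimes> x = x \<and> x \<otimes> f = x}"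

text \<open>The inverse is taken in the ring \<open>g R g\<close>, whose identity is
  \<open>g\<close>; such an element is in general no unit of the ambient ring.\<close>

definition corner_unit :: "'a \<Rightarrow> 'a \<Rightarrow> bool" where
  "corner_unit g u \<longleftrightarrow> u \<in> corner g g \<and> (\<exists>u'\<in>corner g g. u \<otimes> u' = g \<and> u' \<otimes> u = g)"

definition orthogonal_idempotents :: "'a \<Rightarrow> 'a \<Rightarrow> bool" where
  "orthogonal_idempotents e f \<longleftrightarrow>
    e \<in> carrier R \<and> f \<in> carrier R \<and> e \<otimes> e = e \<and> f \<otimes> f = f \<and> e \<otimes> f = \<zero> \<and> f \<otimes> e = \<zero>"

lemma orthogonal_idempotents_sym:
  "orthogonal_idempotents e f \<Longrightarrow> orthogonal_idempotents f e"
  by (simp add: orthogonal_idempotents_def)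

lemma cornerD:
  assumes "x \<in> corner e f"
  shows "x \<in> carrier R" "e \<otimes> x = x" "x \<otimes> f = x"
  using assms by (auto simp: corner_def)

lemma corner_add:
  assumes "x \<in> corner e f" "y \<in> corner e f" "e \<in> carrier R" "f \<in> carrier R"
  shows "x \<oplus> y \<in> corner e f"
  using assms by (auto simp: corner_def l_distr r_distr)

lemma corner_minus:
  assumes "x \<in> corner e f" "y \<in> corner e f" "e \<in> carrier R" "f \<in> carrier R"
  shows "x \<ominus> y \<in> corner e f"
  using assms by (auto simp: corner_def l_distr r_distr minus_eq l_minus r_minus)

lemma corner_mult:
  assumes "x \<in> corner e f" "y \<in> corner f g" "e \<in> carrier R" "g \<in> carrier R"
  shows "x \<otimes> y \<in> corner e g"
  using assms by (auto simp: corner_def m_assoc) (simp flip: m_assoc)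

text \<open>The exponent starts at 1 because the zeroth power is \<open>\<one>\<close> and not the
  identity \<open>e\<close> of the corner.\<close>

lemma corner_pow:
  assumes "x \<in> corner e e" "e \<in> carrier R" "m \<ge> 1"
  shows "x [^] (m::nat) \<in> corner e e"
  using assms(3)
proof (induction m rule: nat_induct_at_least)
  case base
  then show ?case using assms by (simp add: cornerD)
next
  case (Suc m)
  then show ?case using assms by (simp add: corner_mult)
qed

lemma corner_sandwich:
  assumes "x \<in> carrier R" "e \<in> carrier R" "f \<in> carrier R" "e \<otimes> e = e" "f \<otimes> f = f"
  shows "e \<otimes> x \<otimes> f \<in> corner e f"
  using assms by (auto simp: corner_def m_assoc) (simp flip: m_assoc)

lemma corner_orthogonal:
  assumes "x \<in> corner e f" "y \<in> corner f' g" "f \<otimes> f' = \<zero>" "f \<in> carrier R" "f' \<in> carrier R"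
  shows "x \<otimes> y = \<zero>"
proof -
  have "x \<otimes> y = (x \<otimes> f) \<otimes> (f' \<otimes> y)" using assms by (simp add: cornerD)
  also have "\<dots> = x \<otimes> (f \<otimes> f') \<otimes> y"
    using assms(4,5) cornerD(1)[OF assms(1)] cornerD(1)[OF assms(2)] by (simp add: m_assoc)
  finally show ?thesis using assms(3) cornerD(1)[OF assms(1)] cornerD(1)[OF assms(2)] by simp
qed

lemma corner_into_sum:
  assumes o: "orthogonal_idempotents e f"
  shows "x \<in> corner e e \<Longrightarrow> x \<in> corner (e \<oplus> f) (e \<oplus> f)"
    "x \<in> corner e f \<Longrightarrow> x \<in> corner (e \<oplus> f) (e \<oplus> f)"
    "x \<in> corner f e \<Longrightarrow> x \<in> corner (e \<oplus> f) (e \<oplus> f)"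
    "x \<in> corner f f \<Longrightarrow> x \<in> corner (e \<oplus> f) (e \<oplus> f)"
proof -
  have e: "e \<in> carrier R" "f \<in> carrier R" "e \<in> corner e e" "f \<in> corner f f" "e \<otimes> f = \<zero>" "f \<otimes> e = \<zero>"
    using o by (auto simp: corner_def orthogonal_idempotents_def)
  have "x \<in> corner (e \<oplus> f) (e \<oplus> f)" if "i \<in> {e, f}" "j \<in> {e, f}" and x: "x \<in> corner i j" for i j
  proof -
    have "(e \<oplus> f) \<otimes> x = x" "x \<otimes> (e \<oplus> f) = x"
      using that e cornerD[OF x] corner_orthogonal[OF _ x] corner_orthogonal[OF x]
      by (auto simp: l_distr r_distr)
    with x show ?thesis by (simp add: corner_def)
  qed
  then show "x \<in> corner e e \<Longrightarrow> x \<in> corner (e \<oplus> f) (e \<oplus> f)"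
    "x \<in> corner e f \<Longrightarrow> x \<in> corner (e \<oplus> f) (e \<oplus> f)"
    "x \<in> corner f e \<Longrightarrow> x \<in> corner (e \<oplus> f) (e \<oplus> f)"
    "x \<in> corner f f \<Longrightarrow> x \<in> corner (e \<oplus> f) (e \<oplus> f)"
    by blast+
qed

lemma peirce_decomposition:
  assumes o: "orthogonal_idempotents e f" and A: "A \<in> corner (e \<oplus> f) (e \<oplus> f)"
  shows "A = e \<otimes> A \<otimes> e \<oplus> e \<otimes> A \<otimes> f \<oplus> f \<otimes> A \<otimes> e \<oplus> f \<otimes> A \<otimes> f"
proof -
  have e: "e \<in> carrier R" "f \<in> carrier R"
    using o by (auto simp: orthogonal_idempotents_def)
  have "A = (e \<oplus> f) \<otimes> A \<otimes> (e \<oplus> f)" using cornerD[OF A] by simp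
  also have "\<dots> = e \<otimes> A \<otimes> e \<oplus> e \<otimes> A \<otimes> f \<oplus> f \<otimes> A \<otimes> e \<oplus> f \<otimes> A \<otimes> f"
    using cornerD(1)[OF A] e by (simp add: l_distr r_distr a_ac)
  finally show ?thesis .
qed

section \<open>Units of corner rings and block factorizations\<close>

lemma corner_unit_mult:
  assumes "corner_unit g u" "corner_unit g v" "g \<in> carrier R"
  shows "corner_unit g (u \<otimes> v)"
proof -
  obtain u' v' where u: "u \<in> corner g g" "u' \<in> corner g g" "u \<otimes> u' = g" "u' \<otimes> u = g"
    and v: "v \<in> corner g g" "v' \<in> corner g g" "v \<otimes> v' = g" "v' \<otimes> v = g"
    using assms by (auto simp: corner_unit_def)
  note c = cornerD[OF u(1)] cornerD[OF u(2)] cornerD[OF v(1)] cornerD[OF v(2)]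
  have "(u \<otimes> v) \<otimes> (v' \<otimes> u') = u \<otimes> (v \<otimes> v') \<otimes> u'"
    using c by (simp add: m_assoc del: v)
  moreover have "(v' \<otimes> u') \<otimes> (u \<otimes> v) = v' \<otimes> (u' \<otimes> u) \<otimes> v"
    using c by (simp add: m_assoc)
  ultimately show ?thesis
    using u v c assms(3) unfolding corner_unit_def
    by (intro conjI bexI[of _ "v' \<otimes> u'"]) (simp_all add: corner_mult)
qed

lemma corner_unit_sum:
  assumes o: "orthogonal_idempotents e f" and "corner_unit e u" "corner_unit f v"
  shows "corner_unit (e \<oplus> f) (u \<oplus> v)"
proof -
  obtain u' v' where u: "u \<in> corner e e" "u' \<in> corner e e" "u \<otimes> u' = e" "u' \<otimes> u = e"
    and v: "v \<in> corner f f" "v' \<in> corner f f" "v \<otimes> v' = f" "v' \<otimes> v = f"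
    using assms by (auto simp: corner_unit_def)
  have e: "e \<in> carrier R" "f \<in> carrier R" "e \<otimes> f = \<zero>" "f \<otimes> e = \<zero>"
    using o by (auto simp: orthogonal_idempotents_def)
  have z: "u \<otimes> v' = \<zero>" "v \<otimes> u' = \<zero>" "u' \<otimes> v = \<zero>" "v' \<otimes> u = \<zero>"
    using u v e corner_orthogonal by blast+
  note c = cornerD(1)[OF u(1)] cornerD(1)[OF u(2)] cornerD(1)[OF v(1)] cornerD(1)[OF v(2)]
  have "(u \<oplus> v) \<otimes> (u' \<oplus> v') = e \<oplus> f" "(u' \<oplus> v') \<otimes> (u \<oplus> v) = e \<oplus> f"
    using c z u(3,4) v(3,4) e by (simp_all add: l_distr r_distr)
  moreover have "u \<oplus> v \<in> corner (e \<oplus> f) (e \<oplus> f)" "u' \<oplus> v' \<in> corner (e \<oplus> f) (e \<oplus> f)"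
    using u(1,2) v(1,2) e(1,2) by (auto intro!: corner_add intro: corner_into_sum[OF o])
  ultimately show ?thesis
    by (auto simp: corner_unit_def)
qed

text \<open>Since \<open>f \<otimes> e = \<zero>\<close>, the off-diagonal \<open>p\<close> squares
  to zero. Adding it to the identity of the corner and subtracting it therefore give mutually
  inverse elements, the elementary block matrices.\<close>

lemma corner_elementary:
  assumes o: "orthogonal_idempotents e f" and p: "p \<in> corner e f"
  shows "e \<oplus> f \<oplus> p \<in> corner (e \<oplus> f) (e \<oplus> f)" "e \<oplus> f \<ominus> p \<in> corner (e \<oplus> f) (e \<oplus> f)"
    "(e \<oplus> f \<oplus> p) \<otimes> (e \<oplus> f \<ominus> p) = e \<oplus> f" "(e \<oplus> f \<ominus> p) \<otimes> (e \<oplus> f \<oplus> p) = e \<oplus> f"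
proof -
  have e: "e \<in> carrier R" "f \<in> carrier R" "e \<in> corner e e" "f \<in> corner f f" "f \<otimes> e = \<zero>"
    using o by (auto simp: corner_def orthogonal_idempotents_def)
  define g where "g = e \<oplus> f"
  have g: "g \<in> carrier R" "g \<in> corner g g" "p \<in> corner g g"
    using o e p by (auto simp: g_def intro!: corner_add intro: corner_into_sum[OF o])
  have pp: "p \<otimes> p = \<zero>" using corner_orthogonal[OF p p] e by simp
  show "e \<oplus> f \<oplus> p \<in> corner (e \<oplus> f) (e \<oplus> f)" "e \<oplus> f \<ominus> p \<in> corner (e \<oplus> f) (e \<oplus> f)"
    using g corner_add corner_minus by (auto simp flip: g_def)
  note c = cornerD[OF g(2)] cornerD[OF g(3)]
  have "(g \<oplus> p) \<otimes> (g \<ominus> p) = g \<otimes> g \<ominus> g \<otimes> p \<oplus> p \<otimes> g \<ominus> p \<otimes> p"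
    using g(1) c(4) by algebra
  also have "\<dots> = g \<ominus> p \<oplus> p \<ominus> \<zero>" using c pp by simp
  also have "\<dots> = g" using g(1) c(4) by algebra
  finally show "(e \<oplus> f \<oplus> p) \<otimes> (e \<oplus> f \<ominus> p) = e \<oplus> f" by (simp add: g_def)
  have "(g \<ominus> p) \<otimes> (g \<oplus> p) = g \<otimes> g \<oplus> g \<otimes> p \<ominus> p \<otimes> g \<ominus> p \<otimes> p"
    using g(1) c(4) by algebra
  also have "\<dots> = g \<oplus> p \<ominus> p \<ominus> \<zero>" using c pp by simp
  also have "\<dots> = g" using g(1) c(4) by algebra
  finally show "(e \<oplus> f \<ominus> p) \<otimes> (e \<oplus> f \<oplus> p) = e \<oplus> f" by (simp add: g_def)
qed

lemma corner_unit_elementary: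
  assumes "orthogonal_idempotents e f" "p \<in> corner e f"
  shows "corner_unit (e \<oplus> f) (e \<oplus> f \<oplus> p)"
  using corner_elementary[OF assms] unfolding corner_unit_def by blast

text \<open>Block LDU factorization: with \<open>g = e \<oplus> f\<close>, the element is the
  product of the lower elementary factor \<open>g \<oplus> c \<otimes> u'\<close>, the diagonal unit
  \<open>u \<oplus> v\<close> and the upper elementary factor
  \<open>g \<oplus> u' \<otimes> b\<close>. Thus \<open>v\<close> is its Schur complement.\<close>

lemma corner_unit_schur:
  assumes o: "orthogonal_idempotents e f"
    and u: "u \<in> corner e e" "u' \<in> corner e e" "u \<otimes> u' = e" "u' \<otimes> u = e"
    and v: "corner_unit f v" and b: "b \<in> corner e f" and c: "c \<in> corner f e"
  shows "corner_unit (e \<oplus> f) (u \<oplus> b \<oplus> c \<oplus> (v \<oplus> c \<otimes> u' \<otimes> b))"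
proof -
  have e: "e \<in> carrier R" "f \<in> carrier R" "e \<otimes> f = \<zero>" "f \<otimes> e = \<zero>"
    using o by (auto simp: orthogonal_idempotents_def)
  define g p q where "g = e \<oplus> f" and "p = c \<otimes> u'" and "q = u' \<otimes> b"
  have p: "p \<in> corner f e" and q: "q \<in> corner e f"
    using u b c e by (auto simp: p_def q_def intro: corner_mult)
  have vc: "v \<in> corner f f" using v by (simp add: corner_unit_def)
  have "corner_unit g (g \<oplus> p)"
    using corner_unit_elementary[OF orthogonal_idempotents_sym[OF o] p] e
    by (simp add: g_def a_comm)
  moreover have "corner_unit g (u \<oplus> v)"
    using corner_unit_sum[OF o _ v] u unfolding corner_unit_def g_def by blast
  moreover have "corner_unit g (g \<oplus> q)"
    using corner_unit_elementary[OF o q] by (simp add: g_def)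
  ultimately have U: "corner_unit g ((g \<oplus> p) \<otimes> (u \<oplus> v) \<otimes> (g \<oplus> q))"
    using e by (auto simp: g_def intro!: corner_unit_mult)
  have g: "u \<in> corner g g" "v \<in> corner g g" "c \<in> corner g g"
    unfolding g_def using u(1) vc c by (auto intro: corner_into_sum[OF o])
  have z: "p \<otimes> v = \<zero>" "v \<otimes> q = \<zero>"
    using p q vc e corner_orthogonal by blast+
  have pu: "p \<otimes> u = c"
    using u cornerD[OF c] by (simp add: p_def m_assoc cornerD)
  have uq: "u \<otimes> q = b"
    using u cornerD[OF b] by (simp add: q_def cornerD flip: m_assoc)
  have cq: "c \<otimes> q = c \<otimes> u' \<otimes> b"
    using u b c by (simp add: q_def cornerD m_assoc)
  have gc: "g \<in> carrier R" using e by (simp add: g_def)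
  note cl = cornerD(1)[OF p] cornerD(1)[OF q] cornerD[OF g(1)] cornerD[OF g(2)] cornerD[OF g(3)]
    cornerD(1)[OF b] gc
  have "(g \<oplus> p) \<otimes> (u \<oplus> v) = u \<oplus> v \<oplus> c"
    using cl by (simp add: l_distr r_distr z pu a_ac)
  then have "(g \<oplus> p) \<otimes> (u \<oplus> v) \<otimes> (g \<oplus> q) = (u \<oplus> v \<oplus> c) \<otimes> (g \<oplus> q)"
    by simp
  also have "\<dots> = u \<oplus> b \<oplus> c \<oplus> (v \<oplus> c \<otimes> u' \<otimes> b)"
    using cl cornerD(1)[OF u(2)] by (simp add: l_distr r_distr z uq cq a_ac)
  finally show ?thesis using U by (simp add: g_def)
qed

text \<open>The inner factors \<open>w' \<otimes> w = g\<close> are absorbed by \<open>x\<close>, so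
  the product telescopes. At exponent zero the left side would be \<open>\<one>\<close> and the
  right side \<open>w \<otimes> w'\<close>, hence the bound on \<open>m\<close>.\<close>

lemma pow_conj:
  assumes "w \<in> carrier R" "w' \<in> carrier R" "x \<in> corner g g" "w' \<otimes> w = g" "g \<in> carrier R"
    "m \<ge> 1"
  shows "(w \<otimes> x \<otimes> w') [^] (m::nat) = w \<otimes> x [^] m \<otimes> w'"
  using assms(6)
proof (induction m rule: nat_induct_at_least)
  case base
  then show ?case using assms by (simp add: cornerD)
next
  case (Suc m)
  note x = cornerD[OF assms(3)]
  have "(w \<otimes> x [^] m \<otimes> w') \<otimes> (w \<otimes> x \<otimes> w') = w \<otimes> x [^] m \<otimes> ((w' \<otimes> w) \<otimes> x) \<otimes> w'"
    using assms(1,2) x(1) by (simp add: m_assoc)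
  also have "\<dots> = w \<otimes> x [^] Suc m \<otimes> w'"
    using assms(1,2,4) x by (simp add: m_assoc)
  finally show ?case using Suc by simp
qed

end

section \<open>Fine elements of a corner, modulo an ideal\<close>

context ideal
begin

text \<open>Later \<open>I\<close> consists of the matrices over the radical of the base ring. These
  lie in the radical of the matrix ring, so nilpotency modulo \<open>I\<close> gives membership in
  \<open>sqrt_jacobson\<close>.\<close>

definition nilpotent_mod :: "'a \<Rightarrow> bool" where
  "nilpotent_mod a \<longleftrightarrow> (\<exists>m::nat. m \<ge> 1 \<and> a [^] m \<in> I)"

definition fine_at :: "'a \<Rightarrow> 'a \<Rightarrow> bool" where
  "fine_at g x \<longleftrightarrow>
    (\<exists>u a. corner_unit g u \<and> a \<in> corner g g \<and> nilpotent_mod a \<and> x = u \<oplus> a)"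

text \<open>The statement carried through the induction on the block size. For \<open>g\<close> the
  identity it is the desired decomposition, with \<open>I\<close> in place of the radical.\<close>

definition fine_corner :: "'a \<Rightarrow> bool" where
  "fine_corner g \<longleftrightarrow> (\<forall>x\<in>corner g g - I. fine_at g x)"

text \<open>Substitutes for simplicity of the quotient by \<open>I\<close>: they let the Schur complement below be
  moved out of \<open>I\<close>.\<close>

definition linked :: "'a \<Rightarrow> 'a \<Rightarrow> bool" where
  "linked e f \<longleftrightarrow>
    (\<forall>z\<in>carrier R - I. z \<otimes> e = z \<longrightarrow> (\<exists>y\<in>corner e f. z \<otimes> y \<notin> I)) \<and>
    (\<forall>z\<in>carrier R - I. e \<otimes> z = z \<longrightarrow> (\<exists>x\<in>corner f e. x \<otimes> z \<notin> I))"

lemmas I_add_closed = additive_subgroup.a_closed[OF additive_subgroup_axioms]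
lemmas I_inv_closed = additive_subgroup.a_inv_closed[OF additive_subgroup_axioms]

section \<open>Nilpotency modulo the ideal and transport of decompositions\<close>

lemma pow_mem_mono:
  assumes "a \<in> carrier R" "a [^] (m::nat) \<in> I" "m \<le> k"
  shows "a [^] k \<in> I"
proof -
  have "a [^] k = a [^] m \<otimes> a [^] (k - m)"
    using assms by (simp add: nat_pow_mult)
  then show ?thesis using assms by (simp add: I_r_closed)
qed

text \<open>Powers of a block triangular element have the powers of \<open>t\<close> and
  \<open>s\<close> on the diagonal. Once both are in \<open>I\<close>, the power is congruent to an
  off-diagonal \<open>Y\<close> with \<open>Y \<otimes> Y = \<zero>\<close>, so its square is in
  \<open>I\<close>.\<close>

lemma nilpotent_mod_triangular:
  assumes o: "orthogonal_idempotents e f"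
    and t: "t \<in> corner e e" "nilpotent_mod t" and s: "s \<in> corner f f" "nilpotent_mod s"
    and y: "y \<in> corner e f"
  shows "nilpotent_mod (t \<oplus> y \<oplus> s)"
proof -
  have e: "e \<in> carrier R" "f \<in> carrier R" "e \<otimes> f = \<zero>" "f \<otimes> e = \<zero>"
    using o by (auto simp: orthogonal_idempotents_def)
  note cl = cornerD(1)[OF t(1)] cornerD(1)[OF s(1)] cornerD(1)[OF y]
  define N where "N = t \<oplus> y \<oplus> s"
  have NR: "N \<in> carrier R" using cl by (simp add: N_def)
  have form: "\<exists>Y\<in>corner e f. N [^] m = t [^] m \<oplus> Y \<oplus> s [^] m" if "m \<ge> 1" for m :: nat
    using that
  proof (induction m rule: nat_induct_at_least)
    case base
    then show ?case using y cl by (auto simp: N_def)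
  next
    case (Suc m)
    then obtain Y where Y: "Y \<in> corner e f" "N [^] m = t [^] m \<oplus> Y \<oplus> s [^] m"
      by blast
    define T S where "T = t [^] m" and "S = s [^] m"
    have TS: "T \<in> corner e e" "S \<in> corner f f"
      using corner_pow t s e Suc by (auto simp: T_def S_def)
    have z: "T \<otimes> s = \<zero>" "Y \<otimes> t = \<zero>" "Y \<otimes> y = \<zero>" "S \<otimes> t = \<zero>" "S \<otimes> y = \<zero>"
      using TS Y t s y e corner_orthogonal by blast+
    note cl' = cl cornerD(1)[OF TS(1)] cornerD(1)[OF TS(2)] cornerD(1)[OF Y(1)]
    have "N [^] Suc m = (T \<oplus> Y \<oplus> S) \<otimes> (t \<oplus> y \<oplus> s)"
      by (simp add: Y(2) T_def S_def flip: N_def)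
    also have "\<dots> = T \<otimes> t \<oplus> (T \<otimes> y \<oplus> Y \<otimes> s) \<oplus> S \<otimes> s"
      using cl' by (simp add: l_distr r_distr z a_ac)
    finally have "N [^] Suc m = t [^] Suc m \<oplus> (T \<otimes> y \<oplus> Y \<otimes> s) \<oplus> s [^] Suc m"
      by (simp add: T_def S_def)
    moreover have "T \<otimes> y \<oplus> Y \<otimes> s \<in> corner e f"
      using TS Y y s e by (auto intro!: corner_add corner_mult)
    ultimately show ?case by blast
  qed
  obtain p q :: nat where p: "p \<ge> 1" "t [^] p \<in> I" and q: "q \<ge> 1" "s [^] q \<in> I"
    using t s by (auto simp: nilpotent_mod_def)
  \<comment> \<open>The sum bounds both exponents, so both diagonal powers are in \<open>I\<close>
    at exponent \<open>m\<close>.\<close>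
  define m where "m = p + q"
  have m: "m \<ge> 1" using p by (simp add: m_def)
  obtain Y where Y: "Y \<in> corner e f" "N [^] m = t [^] m \<oplus> Y \<oplus> s [^] m"
    using form[OF m] by blast
  define T S where "T = t [^] m" and "S = s [^] m"
  have TS: "T \<in> I" "S \<in> I"
    using pow_mem_mono p q cl by (auto simp: T_def S_def m_def)
  have YY: "Y \<otimes> Y = \<zero>" using corner_orthogonal[OF Y(1) Y(1)] e by simp
  note cl' = a_Hcarr[OF TS(1)] a_Hcarr[OF TS(2)] cornerD(1)[OF Y(1)]
  have "N [^] (m + m) = (T \<oplus> Y \<oplus> S) \<otimes> (T \<oplus> Y \<oplus> S)"
    using NR by (simp add: Y(2) T_def S_def flip: nat_pow_mult)
  also have "\<dots> = T \<otimes> (T \<oplus> Y \<oplus> S) \<oplus> S \<otimes> (T \<oplus> Y \<oplus> S) \<oplus> Y \<otimes> T \<oplus> Y \<otimes> S"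
    using cl' by (simp add: l_distr r_distr YY a_ac)
  also have "\<dots> \<in> I"
    using TS cl' by (intro I_add_closed I_l_closed I_r_closed) auto
  finally show ?thesis
    unfolding nilpotent_mod_def N_def[symmetric] using m by (intro exI[of _ "m + m"]) simp
qed

text \<open>Conjugating the two summands back keeps the first a unit and the second nilpotent modulo
  \<open>I\<close>. This permits replacing an element by any conjugate inside the corner.\<close>

lemma fine_at_conj:
  assumes w: "w \<in> corner g g" "w' \<in> corner g g" "w \<otimes> w' = g" "w' \<otimes> w = g"
    and g: "g \<in> carrier R" and x: "x \<in> corner g g" and fine: "fine_at g (w \<otimes> x \<otimes> w')"
  shows "fine_at g x"
proof -
  obtain u a where u: "corner_unit g u" and a: "a \<in> corner g g" "nilpotent_mod a"
    and eq: "w \<otimes> x \<otimes> w' = u \<oplus> a"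
    using fine by (auto simp: fine_at_def)
  have uc: "u \<in> corner g g" using u by (simp add: corner_unit_def)
  note cl = cornerD[OF w(1)] cornerD[OF w(2)] cornerD[OF x] cornerD[OF uc] cornerD[OF a(1)]
  have "corner_unit g w" "corner_unit g w'"
    using w by (auto simp: corner_unit_def)
  then have "corner_unit g (w' \<otimes> u \<otimes> w)"
    using u g corner_unit_mult by blast
  moreover have "w' \<otimes> a \<otimes> w \<in> corner g g"
    using w a g corner_mult by blast
  moreover have "nilpotent_mod (w' \<otimes> a \<otimes> w)"
  proof -
    obtain m :: nat where m: "m \<ge> 1" "a [^] m \<in> I"
      using a by (auto simp: nilpotent_mod_def)
    then have "w' \<otimes> a [^] m \<otimes> w \<in> I"
      using cl by (intro I_r_closed I_l_closed)
    then have "(w' \<otimes> a \<otimes> w) [^] m \<in> I"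
      using pow_conj[of w' w a g m] m cl w a g by simp
    with m show ?thesis by (auto simp: nilpotent_mod_def)
  qed
  moreover have "x = w' \<otimes> u \<otimes> w \<oplus> w' \<otimes> a \<otimes> w"
  proof -
    have "x = (w' \<otimes> w) \<otimes> x \<otimes> (w' \<otimes> w)" using w cl by simp
    also have "\<dots> = w' \<otimes> (w \<otimes> x \<otimes> w') \<otimes> w"
      using cl by (simp add: m_assoc)
    also have "\<dots> = w' \<otimes> u \<otimes> w \<oplus> w' \<otimes> a \<otimes> w"
      unfolding eq using cl by (simp add: l_distr r_distr)
    finally show ?thesis .
  qed
  ultimately show ?thesis unfolding fine_at_def by blast
qed

text \<open>The off-diagonal parts \<open>x\<close> and \<open>y\<close> are shifted from the unit
  summand to the nilpotent one. Splitting the resulting Schur complement as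
  \<open>v \<oplus> s\<close> leaves \<open>v\<close> as the Schur complement of \<open>U\<close>,
  which is thus a unit, while \<open>xy\<close> makes the remainder \<open>N\<close> block
  triangular.\<close>

lemma fine_at_schur:
  assumes o: "orthogonal_idempotents e f"
    and u: "u \<in> corner e e" "u' \<in> corner e e" "u \<otimes> u' = e" "u' \<otimes> u = e"
    and t: "t \<in> corner e e" "nilpotent_mod t"
    and b: "b \<in> corner e f" and c: "c \<in> corner f e" and d: "d \<in> corner f f"
    and x: "x \<in> corner f e" and y: "y \<in> corner e f" and xy: "x = \<zero> \<or> y = \<zero>"
    and fine: "fine_at f (d \<ominus> (c \<ominus> x) \<otimes> u' \<otimes> (b \<ominus> y))"
  shows "fine_at (e \<oplus> f) ((u \<oplus> t) \<oplus> b \<oplus> c \<oplus> d)"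
proof -
  have e: "e \<in> carrier R" "f \<in> carrier R"
    using o by (auto simp: orthogonal_idempotents_def)
  obtain v s where v: "corner_unit f v" and s: "s \<in> corner f f" "nilpotent_mod s"
    and eq: "d \<ominus> (c \<ominus> x) \<otimes> u' \<otimes> (b \<ominus> y) = v \<oplus> s"
    using fine by (auto simp: fine_at_def)
  have vc: "v \<in> corner f f" using v by (simp add: corner_unit_def)
  define U where "U = u \<oplus> (b \<ominus> y) \<oplus> (c \<ominus> x) \<oplus> (v \<oplus> (c \<ominus> x) \<otimes> u' \<otimes> (b \<ominus> y))"
  have U: "corner_unit (e \<oplus> f) U"
    unfolding U_def using b c x y e by (intro corner_unit_schur[OF o u v] corner_minus)
  define N where "N = t \<oplus> (x \<oplus> y) \<oplus> s"
  note cl = cornerD(1)[OF u(1)] cornerD(1)[OF u(2)] cornerD(1)[OF t(1)] cornerD(1)[OF b]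
    cornerD(1)[OF c] cornerD(1)[OF d] cornerD(1)[OF x] cornerD(1)[OF y] cornerD(1)[OF s(1)]
    cornerD(1)[OF vc]
  have "N \<in> corner (e \<oplus> f) (e \<oplus> f)"
    unfolding N_def using t x y s e by (auto intro!: corner_add intro: corner_into_sum[OF o])
  moreover have "nilpotent_mod N"
    using xy
  proof
    assume "x = \<zero>"
    then show ?thesis
      using nilpotent_mod_triangular[OF o t s y] cl by (simp add: N_def)
  next
    \<comment> \<open>Here \<open>N\<close> is lower triangular; exchanging \<open>e\<close> and
      \<open>f\<close> makes it upper triangular.\<close>
    assume "y = \<zero>"
    then show ?thesis
      using nilpotent_mod_triangular[OF orthogonal_idempotents_sym[OF o] s t x] cl
      by (simp add: N_def a_ac)
  qed
  moreover have "(u \<oplus> t) \<oplus> b \<oplus> c \<oplus> d = U \<oplus> N"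
  proof -
    define k where "k = (c \<ominus> x) \<otimes> u' \<otimes> (b \<ominus> y)"
    have k: "k \<in> carrier R" using cl by (simp add: k_def)
    have "d = (d \<ominus> k) \<oplus> k" using cl k by algebra
    then have "d = v \<oplus> s \<oplus> k" by (simp add: k_def eq)
    moreover have "(u \<oplus> t) \<oplus> b \<oplus> c \<oplus> (v \<oplus> s \<oplus> k) =
        u \<oplus> (b \<ominus> y) \<oplus> (c \<ominus> x) \<oplus> (v \<oplus> k) \<oplus> (t \<oplus> (x \<oplus> y) \<oplus> s)"
      using cl k by algebra
    ultimately show ?thesis by (simp add: U_def N_def k_def)
  qed
  ultimately show ?thesis using U unfolding fine_at_def by blast
qed

section \<open>Moving the pivot and the Schur complement out of the ideal\<close>

lemma mem_add_cancel:
  assumes "a \<in> carrier R" "b \<in> I"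
  shows "a \<oplus> b \<in> I \<longleftrightarrow> a \<in> I"
proof
  assume "a \<oplus> b \<in> I"
  then have "(a \<oplus> b) \<oplus> \<ominus> b \<in> I"
    using assms(2) I_add_closed I_inv_closed by blast
  moreover have "(a \<oplus> b) \<oplus> \<ominus> b = a"
    using assms a_Hcarr[OF assms(2)] by (simp add: a_assoc r_neg)
  ultimately show "a \<in> I" by simp
qed (use assms I_add_closed in auto)

text \<open>The pivot block supplies \<open>u\<close> and \<open>t\<close>; it remains to find
  \<open>x\<close> and \<open>y\<close> that put the Schur complement outside \<open>I\<close>. If
  all three other blocks lay in \<open>I\<close>, it would stay in \<open>I\<close> for every
  \<open>x\<close> and \<open>y\<close> with one of them zero; this is why \<open>bcd\<close> is
  assumed.\<close>

lemma fine_at_off_pivot: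
  assumes o: "orthogonal_idempotents e f" and A: "A \<in> corner (e \<oplus> f) (e \<oplus> f)"
    and fine: "fine_corner e" "fine_corner f" and link: "linked e f"
    and a: "e \<otimes> A \<otimes> e \<notin> I"
    and bcd: "e \<otimes> A \<otimes> f \<notin> I \<or> f \<otimes> A \<otimes> e \<notin> I \<or> f \<otimes> A \<otimes> f \<notin> I"
  shows "fine_at (e \<oplus> f) A"
proof -
  have e: "e \<in> carrier R" "f \<in> carrier R" "e \<otimes> e = e" "f \<otimes> f = f"
    using o by (auto simp: orthogonal_idempotents_def)
  have AR: "A \<in> carrier R" using A by (rule cornerD)
  define b c d where "b = e \<otimes> A \<otimes> f" and "c = f \<otimes> A \<otimes> e" and "d = f \<otimes> A \<otimes> f"
  have b: "b \<in> corner e f" and c: "c \<in> corner f e" and d: "d \<in> corner f f"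
    using AR e corner_sandwich by (auto simp: b_def c_def d_def)
  have "e \<otimes> A \<otimes> e \<in> corner e e" using AR e corner_sandwich by blast
  with a fine obtain u t where "corner_unit e u" and t: "t \<in> corner e e" "nilpotent_mod t"
    and eq: "e \<otimes> A \<otimes> e = u \<oplus> t"
    unfolding fine_corner_def fine_at_def by blast
  then obtain u' where u: "u \<in> corner e e" "u' \<in> corner e e" "u \<otimes> u' = e" "u' \<otimes> u = e"
    by (auto simp: corner_unit_def)
  note cl = cornerD[OF b] cornerD[OF c] cornerD[OF d] cornerD[OF u(1)] cornerD[OF u(2)]
  have zc: "\<zero> \<in> corner e f" "\<zero> \<in> corner f e" using e by (auto simp: corner_def)
  have "\<exists>x\<in>corner f e. \<exists>y\<in>corner e f. (x = \<zero> \<or> y = \<zero>) \<and>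
      d \<ominus> (c \<ominus> x) \<otimes> u' \<otimes> (b \<ominus> y) \<notin> I"
  proof (cases "d \<ominus> c \<otimes> u' \<otimes> b \<in> I")
    case False
    \<comment> \<open>The Schur complement is already outside \<open>I\<close>, so nothing is
      shifted: both \<open>x\<close> and \<open>y\<close> are zero.\<close>
    then show ?thesis using zc cl by (auto simp: minus_eq intro!: bexI[of _ \<zero>])
  next
    case True
    consider "c \<notin> I" | "b \<notin> I" | "d \<notin> I" "c \<in> I"
      using bcd unfolding b_def c_def d_def by blast
    then show ?thesis
    proof cases
      case 1
      \<comment> \<open>Taking \<open>x = \<zero>\<close>, a shift by \<open>y\<close> adds
        \<open>c \<otimes> u' \<otimes> y\<close> to a Schur complement in \<open>I\<close>. As
        \<open>u'\<close> is invertible in the corner, \<open>c \<otimes> u'\<close> is outside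
        \<open>I\<close>, and linkedness yields a \<open>y\<close> for which the added term is
        outside too.\<close>
      have "c \<otimes> u' \<notin> I"
      proof
        assume "c \<otimes> u' \<in> I"
        then have "c \<otimes> u' \<otimes> u \<in> I" using cl I_r_closed by blast
        moreover have "c \<otimes> u' \<otimes> u = c" using cl u by (simp add: m_assoc)
        ultimately show False using 1 by simp
      qed
      moreover have "c \<otimes> u' \<otimes> e = c \<otimes> u'" using cl e by (simp add: m_assoc)
      ultimately obtain y where y: "y \<in> corner e f" "c \<otimes> u' \<otimes> y \<notin> I"
        using link cl unfolding linked_def by blast
      have yR: "y \<in> carrier R" using y by (simp add: cornerD)
      have "d \<ominus> (c \<ominus> \<zero>) \<otimes> u' \<otimes> (b \<ominus> y) = c \<otimes> u' \<otimes> y \<oplus> (d \<ominus> c \<otimes> u' \<otimes> b)"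
        using cl(1,4,7,13) yR by algebra
      with True y yR cl have "d \<ominus> (c \<ominus> \<zero>) \<otimes> u' \<otimes> (b \<ominus> y) \<notin> I"
        by (simp add: mem_add_cancel)
      with y zc show ?thesis by blast
    next
      case 2
      \<comment> \<open>The mirror image: \<open>y = \<zero>\<close>, and \<open>x\<close> adds
        \<open>x \<otimes> u' \<otimes> b\<close>.\<close>
      have "u' \<otimes> b \<notin> I"
      proof
        assume "u' \<otimes> b \<in> I"
        then have "u \<otimes> (u' \<otimes> b) \<in> I" using cl I_l_closed by blast
        moreover have "u \<otimes> (u' \<otimes> b) = b" using cl u by (simp flip: m_assoc)
        ultimately show False using 2 by simp
      qed
      moreover have "e \<otimes> (u' \<otimes> b) = u' \<otimes> b" using cl e by (simp flip: m_assoc)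
      ultimately obtain x where x: "x \<in> corner f e" "x \<otimes> (u' \<otimes> b) \<notin> I"
        using link cl unfolding linked_def by blast
      have xR: "x \<in> carrier R" using x by (simp add: cornerD)
      have "d \<ominus> (c \<ominus> x) \<otimes> u' \<otimes> (b \<ominus> \<zero>) = x \<otimes> (u' \<otimes> b) \<oplus> (d \<ominus> c \<otimes> u' \<otimes> b)"
        using cl(1,4,7,13) xR by algebra
      with True x xR cl have "d \<ominus> (c \<ominus> x) \<otimes> u' \<otimes> (b \<ominus> \<zero>) \<notin> I"
        by (simp add: mem_add_cancel)
      with x zc show ?thesis by blast
    next
      case 3
      \<comment> \<open>This case is contradictory: with \<open>c\<close> in \<open>I\<close> the
        Schur complement differs from \<open>d\<close> by an element of \<open>I\<close>, so it
        could not lie in \<open>I\<close>.\<close>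
      have "c \<otimes> u' \<otimes> b \<in> I" using 3 cl by (intro I_r_closed)
      then have "\<ominus> (c \<otimes> u' \<otimes> b) \<in> I" by (rule I_inv_closed)
      with True 3 cl show ?thesis by (simp add: minus_eq mem_add_cancel)
    qed
  qed
  then obtain x y where x: "x \<in> corner f e" and y: "y \<in> corner e f" and xy: "x = \<zero> \<or> y = \<zero>"
    and n: "d \<ominus> (c \<ominus> x) \<otimes> u' \<otimes> (b \<ominus> y) \<notin> I"
    by blast
  have "d \<ominus> (c \<ominus> x) \<otimes> u' \<otimes> (b \<ominus> y) \<in> corner f f"
    using b c d x y u e by (meson corner_minus corner_mult)
  with n fine have "fine_at f (d \<ominus> (c \<ominus> x) \<otimes> u' \<otimes> (b \<ominus> y))"
    by (simp add: fine_corner_def)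
  then have "fine_at (e \<oplus> f) ((u \<oplus> t) \<oplus> b \<oplus> c \<oplus> d)"
    by (rule fine_at_schur[OF o u t b c d x y xy])
  then show ?thesis
    using peirce_decomposition[OF o A] eq by (simp add: b_def c_def d_def)
qed

text \<open>The two blocks in which conjugation helps: the pivot gains \<open>y\<close> times the
  lower left block, and the upper right block gains minus the pivot times \<open>y\<close>. The
  latter term is written first, because the rest lies in \<open>I\<close> when the other three
  blocks do.\<close>

lemma elementary_conj_entries:
  assumes o: "orthogonal_idempotents e f" and A: "A \<in> carrier R" and y: "y \<in> corner e f"
  defines "A' \<equiv> (e \<oplus> f \<oplus> y) \<otimes> A \<otimes> (e \<oplus> f \<ominus> y)"
  shows "e \<otimes> A' \<otimes> e = e \<otimes> A \<otimes> e \<oplus> y \<otimes> (f \<otimes> A \<otimes> e)"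
    and "e \<otimes> A' \<otimes> f = \<ominus> (e \<otimes> A \<otimes> e \<otimes> y) \<oplus>
      (e \<otimes> A \<otimes> f \<oplus> y \<otimes> (f \<otimes> A \<otimes> f) \<ominus> y \<otimes> (f \<otimes> A \<otimes> e) \<otimes> y)"
proof -
  have e: "e \<in> carrier R" "f \<in> carrier R" "e \<otimes> e = e" "f \<otimes> f = f" "e \<otimes> f = \<zero>" "f \<otimes> e = \<zero>"
    using o by (auto simp: orthogonal_idempotents_def)
  note y' = cornerD[OF y]
  have ye: "y \<otimes> e = \<zero>"
    using corner_orthogonal[OF y, of e e] e by (simp add: corner_def)
  have w: "e \<otimes> (e \<oplus> f \<oplus> y) = e \<oplus> y" "(e \<oplus> f \<ominus> y) \<otimes> e = e" "(e \<oplus> f \<ominus> y) \<otimes> f = f \<ominus> y"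
    using e y' ye by (simp_all add: l_distr r_distr minus_eq l_minus r_minus)
  have "e \<otimes> A' \<otimes> e = (e \<otimes> (e \<oplus> f \<oplus> y)) \<otimes> A \<otimes> ((e \<oplus> f \<ominus> y) \<otimes> e)"
    using e(1,2) y'(1) A by (simp add: A'_def m_assoc)
  also have "\<dots> = e \<otimes> A \<otimes> e \<oplus> (y \<otimes> f) \<otimes> A \<otimes> e"
    unfolding w y'(3) using e(1,2) y'(1) A by (simp add: l_distr)
  finally show "e \<otimes> A' \<otimes> e = e \<otimes> A \<otimes> e \<oplus> y \<otimes> (f \<otimes> A \<otimes> e)"
    using e(1,2) y'(1) A by (simp add: m_assoc)
  have "e \<otimes> A' \<otimes> f = (e \<otimes> (e \<oplus> f \<oplus> y)) \<otimes> A \<otimes> ((e \<oplus> f \<ominus> y) \<otimes> f)"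
    using e(1,2) y'(1) A by (simp add: A'_def m_assoc)
  \<comment> \<open>Writing \<open>y\<close> as \<open>y \<otimes> f\<close> on the left and as
    \<open>e \<otimes> y\<close> on the right makes the expansion consist of Peirce blocks of
    \<open>A\<close>.\<close>
  also have "\<dots> = (e \<oplus> y \<otimes> f) \<otimes> A \<otimes> (f \<ominus> e \<otimes> y)"
    unfolding w y' ..
  also have "\<dots> = \<ominus> (e \<otimes> A \<otimes> e \<otimes> y) \<oplus>
      (e \<otimes> A \<otimes> f \<oplus> y \<otimes> (f \<otimes> A \<otimes> f) \<ominus> y \<otimes> (f \<otimes> A \<otimes> e) \<otimes> y)"
    using e(1,2) y'(1) A by algebra
  finally show "e \<otimes> A' \<otimes> f = \<ominus> (e \<otimes> A \<otimes> e \<otimes> y) \<oplus>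
      (e \<otimes> A \<otimes> f \<oplus> y \<otimes> (f \<otimes> A \<otimes> f) \<ominus> y \<otimes> (f \<otimes> A \<otimes> e) \<otimes> y)" .
qed

text \<open>\<open>fine_at_conj\<close> for an elementary matrix. That the conjugate stays in the
  corner is proved here once and handed back as the premise of \<open>fine\<close>.\<close>

lemma fine_at_elementary_conj:
  assumes o: "orthogonal_idempotents e f" and A: "A \<in> corner (e \<oplus> f) (e \<oplus> f)"
    and y: "y \<in> corner e f"
    and fine: "(e \<oplus> f \<oplus> y) \<otimes> A \<otimes> (e \<oplus> f \<ominus> y) \<in> corner (e \<oplus> f) (e \<oplus> f) \<Longrightarrow>
      fine_at (e \<oplus> f) ((e \<oplus> f \<oplus> y) \<otimes> A \<otimes> (e \<oplus> f \<ominus> y))"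
  shows "fine_at (e \<oplus> f) A"
proof -
  have g: "e \<oplus> f \<in> carrier R"
    using o by (auto simp: orthogonal_idempotents_def)
  note w = corner_elementary[OF o y]
  show ?thesis
    using w A g by (intro fine_at_conj[OF w g A] fine corner_mult)
qed

text \<open>Only a block diagonal \<open>A\<close> modulo \<open>I\<close> with zero lower part is
  left after \<open>fine_at_off_pivot\<close>. Linkedness gives \<open>y\<close> with pivot times
  \<open>y\<close> outside \<open>I\<close>; conjugation then moves the upper right block out of
  \<open>I\<close>, while the pivot changes only by an element of \<open>I\<close>.\<close>

lemma fine_at_pivot:
  assumes o: "orthogonal_idempotents e f" and A: "A \<in> corner (e \<oplus> f) (e \<oplus> f)"
    and fine: "fine_corner e" "fine_corner f" and link: "linked e f"
    and a: "e \<otimes> A \<otimes> e \<notin> I"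
  shows "fine_at (e \<oplus> f) A"
proof (cases "e \<otimes> A \<otimes> f \<notin> I \<or> f \<otimes> A \<otimes> e \<notin> I \<or> f \<otimes> A \<otimes> f \<notin> I")
  case True
  then show ?thesis by (rule fine_at_off_pivot[OF o A fine link a])
next
  case False
  then have I: "e \<otimes> A \<otimes> f \<in> I" "f \<otimes> A \<otimes> e \<in> I" "f \<otimes> A \<otimes> f \<in> I" by auto
  have e: "e \<in> carrier R" "f \<in> carrier R" "e \<otimes> e = e"
    using o by (auto simp: orthogonal_idempotents_def)
  have AR: "A \<in> carrier R" using A by (rule cornerD)
  have "e \<otimes> A \<otimes> e \<in> carrier R - I" "e \<otimes> A \<otimes> e \<otimes> e = e \<otimes> A \<otimes> e"
    using a AR e by (simp_all add: m_assoc)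
  then obtain y where y: "y \<in> corner e f" and ay: "e \<otimes> A \<otimes> e \<otimes> y \<notin> I"
    using link unfolding linked_def by blast
  have yR: "y \<in> carrier R" using y by (rule cornerD)
  note entries = elementary_conj_entries[OF o AR y]
  define A' where "A' = (e \<oplus> f \<oplus> y) \<otimes> A \<otimes> (e \<oplus> f \<ominus> y)"
  show ?thesis
  proof (rule fine_at_elementary_conj[OF o A y])
    assume "(e \<oplus> f \<oplus> y) \<otimes> A \<otimes> (e \<oplus> f \<ominus> y) \<in> corner (e \<oplus> f) (e \<oplus> f)"
    then have A': "A' \<in> corner (e \<oplus> f) (e \<oplus> f)" by (simp add: A'_def)
    have "y \<otimes> (f \<otimes> A \<otimes> e) \<in> I"
      by (rule I_l_closed[OF I(2) yR])
    then have "e \<otimes> A' \<otimes> e \<notin> I"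
      unfolding A'_def entries using a AR e mem_add_cancel by simp
    moreover have "e \<otimes> A' \<otimes> f \<notin> I"
    proof -
      have "e \<otimes> A \<otimes> f \<oplus> y \<otimes> (f \<otimes> A \<otimes> f) \<ominus> y \<otimes> (f \<otimes> A \<otimes> e) \<otimes> y \<in> I"
        unfolding minus_eq
        using I I_l_closed[OF I(2) yR] I_l_closed[OF I(3) yR] yR
        by (intro I_add_closed I_inv_closed I_r_closed[of _ y])
      moreover have "\<ominus> (e \<otimes> A \<otimes> e \<otimes> y) \<notin> I"
        using ay AR e yR I_inv_closed[of "\<ominus> (e \<otimes> A \<otimes> e \<otimes> y)"] by auto
      ultimately show ?thesis
        unfolding A'_def entries using AR e yR mem_add_cancel by simp
    qed
    ultimately show "fine_at (e \<oplus> f) ((e \<oplus> f \<oplus> y) \<otimes> A \<otimes> (e \<oplus> f \<ominus> y))"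
      using fine_at_off_pivot[OF o A' fine link] by (simp add: A'_def)
  qed
qed

text \<open>Conjugation adds \<open>y \<otimes> (f \<otimes> A \<otimes> e)\<close> to the pivot.
  Since \<open>f\<close> fixes the lower left block on the left, \<open>linked f e\<close> provides
  a \<open>y\<close> that makes this term, and so the new pivot, lie outside
  \<open>I\<close>.\<close>

lemma fine_at_lower:
  assumes o: "orthogonal_idempotents e f" and A: "A \<in> corner (e \<oplus> f) (e \<oplus> f)"
    and fine: "fine_corner e" "fine_corner f" and link: "linked e f" "linked f e"
    and a: "e \<otimes> A \<otimes> e \<in> I" and c: "f \<otimes> A \<otimes> e \<notin> I"
  shows "fine_at (e \<oplus> f) A"
proof -
  have e: "e \<in> carrier R" "f \<in> carrier R" "f \<otimes> f = f"
    using o by (auto simp: orthogonal_idempotents_def)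
  have AR: "A \<in> carrier R" using A by (rule cornerD)
  have "f \<otimes> A \<otimes> e \<in> carrier R - I" "f \<otimes> (f \<otimes> A \<otimes> e) = f \<otimes> A \<otimes> e"
    using c AR e by (simp_all flip: m_assoc)
  then obtain y where y: "y \<in> corner e f" and yc: "y \<otimes> (f \<otimes> A \<otimes> e) \<notin> I"
    using link(2) unfolding linked_def by blast
  have yR: "y \<in> carrier R" using y by (rule cornerD)
  note entries = elementary_conj_entries(1)[OF o AR y]
  show ?thesis
  proof (rule fine_at_elementary_conj[OF o A y], rule fine_at_pivot[OF o _ fine link(1)])
    show "e \<otimes> ((e \<oplus> f \<oplus> y) \<otimes> A \<otimes> (e \<oplus> f \<ominus> y)) \<otimes> e \<notin> I"
      unfolding entries using a yc AR e yR mem_add_cancel[of "y \<otimes> (f \<otimes> A \<otimes> e)" "e \<otimes> A \<otimes> e"]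
      by (simp add: a_comm)
  qed
qed

text \<open>The induction step. Some Peirce block of \<open>A\<close> is outside \<open>I\<close>;
  exchanging \<open>e\<close> and \<open>f\<close> reduces the four possibilities to a pivot block
  or a lower left block.\<close>

lemma fine_corner_sum:
  assumes o: "orthogonal_idempotents e f"
    and fine: "fine_corner e" "fine_corner f" and link: "linked e f" "linked f e"
  shows "fine_corner (e \<oplus> f)"
  unfolding fine_corner_def
proof
  fix A assume "A \<in> corner (e \<oplus> f) (e \<oplus> f) - I"
  then have A: "A \<in> corner (e \<oplus> f) (e \<oplus> f)" and AI: "A \<notin> I" by auto
  have fe: "e \<oplus> f = f \<oplus> e"
    using o by (simp add: orthogonal_idempotents_def a_comm)
  note A' = A[unfolded fe]
  note o' = orthogonal_idempotents_sym[OF o]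
  have "e \<otimes> A \<otimes> e \<notin> I \<or> f \<otimes> A \<otimes> f \<notin> I \<or> f \<otimes> A \<otimes> e \<notin> I \<or> e \<otimes> A \<otimes> f \<notin> I"
    using AI I_add_closed peirce_decomposition[OF o A] by metis
  then show "fine_at (e \<oplus> f) A"
    using fine_at_pivot[OF o A fine link(1)] fine_at_lower[OF o A fine link]
      fine_at_pivot[OF o' A' fine(2,1) link(2)] fine_at_lower[OF o' A' fine(2,1) link(2,1)]
    unfolding fe by blast
qed

end

section \<open>Matrix units\<close>

context ring
begin

definition matrix_unit :: "nat \<Rightarrow> nat \<Rightarrow> nat \<Rightarrow> 'a \<Rightarrow> 'a mat" where
  "matrix_unit n i j a = mat n n (\<lambda>(r, c). if r = i \<and> c = j then a else \<zero>)"

text \<open>The ambient size \<open>n\<close> stays fixed and the index set \<open>S\<close> varies,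
  so matrices of smaller size appear as corners of one ring and induction on the size becomes
  induction on \<open>S\<close>.\<close>

definition diag_idem :: "nat \<Rightarrow> nat set \<Rightarrow> 'a mat" where
  "diag_idem n S = mat n n (\<lambda>(r, c). if r = c \<and> r \<in> S then \<one> else \<zero>)"

definition matrices_over :: "nat \<Rightarrow> 'a set \<Rightarrow> 'a mat set" where
  "matrices_over n J = {A \<in> carrier (matrix_ring_over n R). \<forall>i<n. \<forall>j<n. A $$ (i, j) \<in> J}"

lemma matrix_unit_carrier: "a \<in> carrier R \<Longrightarrow> matrix_unit n i j a \<in> carrier (matrix_ring_over n R)"
  by (simp add: matrix_unit_def)

lemma diag_idem_carrier: "diag_idem n S \<in> carrier (matrix_ring_over n R)"
  by (simp add: diag_idem_def)

section \<open>Multiplication rules for matrix units and diagonal idempotents\<close>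

lemma finsum_single:
  assumes "i \<in> B" "finite B" "\<And>k. k \<in> B \<Longrightarrow> g k = (if k = i then x else \<zero>)" "x \<in> carrier R"
  shows "(\<Oplus>k\<in>B. g k) = x"
proof -
  have "(\<Oplus>k\<in>B. g k) = (\<Oplus>k\<in>B. if i = k then x else \<zero>)"
    using assms by (intro finsum_cong') auto
  also have "\<dots> = x"
    using assms finsum_singleton[of i B "\<lambda>_. x"] by auto
  finally show ?thesis .
qed

lemma diag_idem_mult:
  assumes "A \<in> carrier (matrix_ring_over n R)"
  shows "diag_idem n S \<otimes>\<^bsub>matrix_ring_over n R\<^esub> A =
    mat n n (\<lambda>(r, c). if r \<in> S then A $$ (r, c) else \<zero>)"
proof (rule eq_matI)
  fix r c assume "r < dim_row (mat n n (\<lambda>(r, c). if r \<in> S then A $$ (r, c) else \<zero>))"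
    "c < dim_col (mat n n (\<lambda>(r, c). if r \<in> S then A $$ (r, c) else \<zero>))"
  then have rc: "r < n" "c < n" by simp_all
  have "(\<Oplus>k\<in>{..<n}. diag_idem n S $$ (r, k) \<otimes> A $$ (k, c)) =
      (if r \<in> S then A $$ (r, c) else \<zero>)"
    by (rule finsum_single[of r]) (use assms rc in \<open>auto simp: diag_idem_def\<close>)
  with rc show "(diag_idem n S \<otimes>\<^bsub>matrix_ring_over n R\<^esub> A) $$ (r, c) =
      mat n n (\<lambda>(r, c). if r \<in> S then A $$ (r, c) else \<zero>) $$ (r, c)"
    by simp
qed simp_all

lemma mult_diag_idem:
  assumes "A \<in> carrier (matrix_ring_over n R)"
  shows "A \<otimes>\<^bsub>matrix_ring_over n R\<^esub> diag_idem n S =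
    mat n n (\<lambda>(r, c). if c \<in> S then A $$ (r, c) else \<zero>)"
proof (rule eq_matI)
  fix r c assume "r < dim_row (mat n n (\<lambda>(r, c). if c \<in> S then A $$ (r, c) else \<zero>))"
    "c < dim_col (mat n n (\<lambda>(r, c). if c \<in> S then A $$ (r, c) else \<zero>))"
  then have rc: "r < n" "c < n" by simp_all
  have "(\<Oplus>k\<in>{..<n}. A $$ (r, k) \<otimes> diag_idem n S $$ (k, c)) =
      (if c \<in> S then A $$ (r, c) else \<zero>)"
    by (rule finsum_single[of c]) (use assms rc in \<open>auto simp: diag_idem_def\<close>)
  with rc show "(A \<otimes>\<^bsub>matrix_ring_over n R\<^esub> diag_idem n S) $$ (r, c) =
      mat n n (\<lambda>(r, c). if c \<in> S then A $$ (r, c) else \<zero>) $$ (r, c)"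
    by simp
qed simp_all

lemma matrix_unit_mult:
  assumes "A \<in> carrier (matrix_ring_over n R)" "a \<in> carrier R" "j < n"
  shows "matrix_unit n i j a \<otimes>\<^bsub>matrix_ring_over n R\<^esub> A =
    mat n n (\<lambda>(r, c). if r = i then a \<otimes> A $$ (j, c) else \<zero>)"
proof (rule eq_matI)
  fix r c assume "r < dim_row (mat n n (\<lambda>(r, c). if r = i then a \<otimes> A $$ (j, c) else \<zero>))"
    "c < dim_col (mat n n (\<lambda>(r, c). if r = i then a \<otimes> A $$ (j, c) else \<zero>))"
  then have rc: "r < n" "c < n" by simp_all
  have "(\<Oplus>k\<in>{..<n}. matrix_unit n i j a $$ (r, k) \<otimes> A $$ (k, c)) =
      (if r = i then a \<otimes> A $$ (j, c) else \<zero>)"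
    by (rule finsum_single[of j]) (use assms rc in \<open>auto simp: matrix_unit_def\<close>)
  with rc show "(matrix_unit n i j a \<otimes>\<^bsub>matrix_ring_over n R\<^esub> A) $$ (r, c) =
      mat n n (\<lambda>(r, c). if r = i then a \<otimes> A $$ (j, c) else \<zero>) $$ (r, c)"
    by simp
qed simp_all

lemma mult_matrix_unit:
  assumes "A \<in> carrier (matrix_ring_over n R)" "a \<in> carrier R" "i < n"
  shows "A \<otimes>\<^bsub>matrix_ring_over n R\<^esub> matrix_unit n i j a =
    mat n n (\<lambda>(r, c). if c = j then A $$ (r, i) \<otimes> a else \<zero>)"
proof (rule eq_matI)
  fix r c assume "r < dim_row (mat n n (\<lambda>(r, c). if c = j then A $$ (r, i) \<otimes> a else \<zero>))"
    "c < dim_col (mat n n (\<lambda>(r, c). if c = j then A $$ (r, i) \<otimes> a else \<zero>))"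
  then have rc: "r < n" "c < n" by simp_all
  have "(\<Oplus>k\<in>{..<n}. A $$ (r, k) \<otimes> matrix_unit n i j a $$ (k, c)) =
      (if c = j then A $$ (r, i) \<otimes> a else \<zero>)"
    by (rule finsum_single[of i]) (use assms rc in \<open>auto simp: matrix_unit_def\<close>)
  with rc show "(A \<otimes>\<^bsub>matrix_ring_over n R\<^esub> matrix_unit n i j a) $$ (r, c) =
      mat n n (\<lambda>(r, c). if c = j then A $$ (r, i) \<otimes> a else \<zero>) $$ (r, c)"
    by simp
qed simp_all

lemma matrix_unit_mult_matrix_unit:
  assumes "a \<in> carrier R" "b \<in> carrier R" "j < n"
  shows "matrix_unit n i j a \<otimes>\<^bsub>matrix_ring_over n R\<^esub> matrix_unit n j k b =
    matrix_unit n i k (a \<otimes> b)"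
  using assms
  by (subst matrix_unit_mult) (auto intro!: eq_matI simp: matrix_unit_def)

lemma matrix_unit_add:
  assumes "a \<in> carrier R" "b \<in> carrier R"
  shows "matrix_unit n i j (a \<oplus> b) =
    matrix_unit n i j a \<oplus>\<^bsub>matrix_ring_over n R\<^esub> matrix_unit n i j b"
  using assms by (auto intro!: eq_matI simp: matrix_unit_def)

lemma diag_idem_singleton: "diag_idem n {i} = matrix_unit n i i \<one>"
  by (auto intro!: eq_matI simp: matrix_unit_def diag_idem_def)

lemma diag_idem_all: "diag_idem n {..<n} = \<one>\<^bsub>matrix_ring_over n R\<^esub>"
  by (auto intro!: eq_matI simp: diag_idem_def)

lemma diag_idem_union:
  assumes "S \<inter> T = {}"
  shows "diag_idem n (S \<union> T) = diag_idem n S \<oplus>\<^bsub>matrix_ring_over n R\<^esub> diag_idem n T"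
  using assms by (auto intro!: eq_matI simp: diag_idem_def)

lemma diag_idem_orthogonal:
  assumes "S \<inter> T = {}"
  shows "ring.orthogonal_idempotents (matrix_ring_over n R) (diag_idem n S) (diag_idem n T)"
proof -
  interpret M: ring "matrix_ring_over n R" by (rule matrix_ring_over_is_ring)
  show ?thesis
    unfolding M.orthogonal_idempotents_def
    using assms
    by (auto simp del: matrix_ring_over_simps(2) simp: diag_idem_carrier diag_idem_mult
        simp del: matrix_ring_over_simps(1)) (auto intro!: eq_matI simp: diag_idem_def)
qed

text \<open>The bridge between Peirce blocks and entries: it reduces membership in an additive
  subgroup to single entries and identifies a corner of size one with the base ring.\<close>

lemma diag_idem_mult_diag_idem:
  assumes "A \<in> carrier (matrix_ring_over n R)"
  shows "diag_idem n {i} \<otimes>\<^bsub>matrix_ring_over n R\<^esub> (A \<otimes>\<^bsub>matrix_ring_over n R\<^esub> diag_idem n {j}) =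
    matrix_unit n i j (A $$ (i, j))"
proof -
  have "A \<otimes>\<^bsub>matrix_ring_over n R\<^esub> diag_idem n {j} \<in> carrier (matrix_ring_over n R)"
    using assms by (simp only: mult_diag_idem) simp
  from diag_idem_mult[OF this] show ?thesis
    unfolding mult_diag_idem[OF assms]
    by (auto intro!: eq_matI simp: matrix_unit_def)
qed

lemma matrix_unit_corner:
  assumes "a \<in> carrier R" "i < n" "j < n" "i \<in> S" "j \<in> T"
  shows "matrix_unit n i j a \<in> ring.corner (matrix_ring_over n R) (diag_idem n S) (diag_idem n T)"
proof -
  interpret M: ring "matrix_ring_over n R" by (rule matrix_ring_over_is_ring)
  show ?thesis
    unfolding M.corner_def mem_Collect_eq
      diag_idem_mult[OF matrix_unit_carrier[OF assms(1)]]
      mult_diag_idem[OF matrix_unit_carrier[OF assms(1)]]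
    using assms by (auto intro!: eq_matI simp: matrix_unit_def)
qed

section \<open>Ideals of matrices and assembly from columns and rows\<close>

lemma finsum_in_ideal:
  assumes "ideal J R" "finite B" "\<And>k. k \<in> B \<Longrightarrow> g k \<in> J"
  shows "(\<Oplus>k\<in>B. g k) \<in> J"
proof -
  interpret J: ideal J R by fact
  show ?thesis
    using assms(2,3)
  proof (induction B rule: finite_induct)
    case empty
    then show ?case
      using additive_subgroup.zero_closed[OF J.additive_subgroup_axioms] by simp
  next
    case (insert x F)
    then show ?case
      using J.I_add_closed J.a_Hcarr by (subst finsum_insert) auto
  qed
qed

lemma matrices_over_ideal:
  assumes "ideal J R"
  shows "ideal (matrices_over n J) (matrix_ring_over n R)"
proof -
  interpret J: ideal J R by fact
  interpret M: ring "matrix_ring_over n R" by (rule matrix_ring_over_is_ring)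
  have left: "X \<otimes>\<^bsub>matrix_ring_over n R\<^esub> A \<in> matrices_over n J"
    if "A \<in> matrices_over n J" "X \<in> carrier (matrix_ring_over n R)" for A X
  proof -
    have "X \<otimes>\<^bsub>matrix_ring_over n R\<^esub> A \<in> carrier (matrix_ring_over n R)"
      using that unfolding matrices_over_def by blast
    then show ?thesis
      using that unfolding matrices_over_def
      by (auto intro!: finsum_in_ideal[OF assms] J.I_l_closed)
  qed
  show ?thesis
  proof (rule idealI)
    show "ring (matrix_ring_over n R)" by (rule M.ring_axioms)
    show "subgroup (matrices_over n J) (add_monoid (matrix_ring_over n R))"
    proof (rule M.add.subgroupI)
      show "matrices_over n J \<subseteq> carrier (matrix_ring_over n R)"
        unfolding matrices_over_def by blast
      have "\<zero>\<^bsub>matrix_ring_over n R\<^esub> \<in> matrices_over n J"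
        using additive_subgroup.zero_closed[OF J.additive_subgroup_axioms]
        by (simp add: matrices_over_def)
      then show "matrices_over n J \<noteq> {}" by blast
    next
      fix A assume A: "A \<in> matrices_over n J"
      then have AM: "A \<in> carrier (matrix_ring_over n R)" unfolding matrices_over_def by blast
      \<comment> \<open>Negation is left multiplication by minus the identity, so it is covered by
        \<open>left\<close>.\<close>
      have "\<ominus>\<^bsub>matrix_ring_over n R\<^esub> A =
          \<ominus>\<^bsub>matrix_ring_over n R\<^esub> \<one>\<^bsub>matrix_ring_over n R\<^esub> \<otimes>\<^bsub>matrix_ring_over n R\<^esub> A"
        using M.l_minus[OF M.one_closed AM] M.l_one[OF AM] by metis
      then show "\<ominus>\<^bsub>matrix_ring_over n R\<^esub> A \<in> matrices_over n J"
        using left[OF A M.a_inv_closed[OF M.one_closed]] by metis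
    next
      fix A B assume "A \<in> matrices_over n J" "B \<in> matrices_over n J"
      then show "A \<oplus>\<^bsub>matrix_ring_over n R\<^esub> B \<in> matrices_over n J"
        by (auto simp: matrices_over_def J.I_add_closed)
    qed
  next
    fix A X assume A: "A \<in> matrices_over n J" "X \<in> carrier (matrix_ring_over n R)"
    then show "X \<otimes>\<^bsub>matrix_ring_over n R\<^esub> A \<in> matrices_over n J" by (rule left)
    have "A \<otimes>\<^bsub>matrix_ring_over n R\<^esub> X \<in> carrier (matrix_ring_over n R)"
      using A unfolding matrices_over_def by blast
    then show "A \<otimes>\<^bsub>matrix_ring_over n R\<^esub> X \<in> matrices_over n J"
      using A unfolding matrices_over_def
      by (auto intro!: finsum_in_ideal[OF assms] J.I_r_closed)
  qed
qed

text \<open>The identity is the sum of the idempotents of single indices, so \<open>A\<close> is the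
  sum of its columns; the induction adds one column at a time.\<close>

lemma additive_subgroup_columns:
  assumes G: "additive_subgroup G (matrix_ring_over n R)"
    and A: "A \<in> carrier (matrix_ring_over n R)"
    and col: "\<And>j. j < n \<Longrightarrow> A \<otimes>\<^bsub>matrix_ring_over n R\<^esub> diag_idem n {j} \<in> G"
  shows "A \<in> G"
proof -
  interpret M: ring "matrix_ring_over n R" by (rule matrix_ring_over_is_ring)
  have "A \<otimes>\<^bsub>matrix_ring_over n R\<^esub> diag_idem n {..<m} \<in> G" if "m \<le> n" for m
    using that
  proof (induction m)
    case 0
    have "diag_idem n {..<0} = \<zero>\<^bsub>matrix_ring_over n R\<^esub>"
      by (simp add: diag_idem_def)
    then show ?case
      using additive_subgroup.zero_closed[OF G] M.r_null[OF A] by metis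
  next
    case (Suc m)
    have "diag_idem n {..<Suc m} = diag_idem n {..<m} \<oplus>\<^bsub>matrix_ring_over n R\<^esub> diag_idem n {m}"
      by (subst diag_idem_union[symmetric]) (auto simp: lessThan_Suc)
    then have "A \<otimes>\<^bsub>matrix_ring_over n R\<^esub> diag_idem n {..<Suc m} =
      A \<otimes>\<^bsub>matrix_ring_over n R\<^esub> diag_idem n {..<m} \<oplus>\<^bsub>matrix_ring_over n R\<^esub>
      A \<otimes>\<^bsub>matrix_ring_over n R\<^esub> diag_idem n {m}"
      using M.r_distr[OF diag_idem_carrier diag_idem_carrier A] by metis
    moreover have "A \<otimes>\<^bsub>matrix_ring_over n R\<^esub> diag_idem n {..<m} \<in> G"
      "A \<otimes>\<^bsub>matrix_ring_over n R\<^esub> diag_idem n {m} \<in> G"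
      using Suc col by simp_all
    ultimately show ?case using additive_subgroup.a_closed[OF G] by metis
  qed
  from this[OF order.refl] show ?thesis
    unfolding diag_idem_all M.r_one[OF A] .
qed

lemma additive_subgroup_rows:
  assumes G: "additive_subgroup G (matrix_ring_over n R)"
    and A: "A \<in> carrier (matrix_ring_over n R)"
    and row: "\<And>i. i < n \<Longrightarrow> diag_idem n {i} \<otimes>\<^bsub>matrix_ring_over n R\<^esub> A \<in> G"
  shows "A \<in> G"
proof -
  interpret M: ring "matrix_ring_over n R" by (rule matrix_ring_over_is_ring)
  have "diag_idem n {..<m} \<otimes>\<^bsub>matrix_ring_over n R\<^esub> A \<in> G" if "m \<le> n" for m
    using that
  proof (induction m)
    case 0
    have "diag_idem n {..<0} = \<zero>\<^bsub>matrix_ring_over n R\<^esub>"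
      by (simp add: diag_idem_def)
    then show ?case
      using additive_subgroup.zero_closed[OF G] M.l_null[OF A] by metis
  next
    case (Suc m)
    have "diag_idem n {..<Suc m} = diag_idem n {..<m} \<oplus>\<^bsub>matrix_ring_over n R\<^esub> diag_idem n {m}"
      by (subst diag_idem_union[symmetric]) (auto simp: lessThan_Suc)
    then have "diag_idem n {..<Suc m} \<otimes>\<^bsub>matrix_ring_over n R\<^esub> A =
      diag_idem n {..<m} \<otimes>\<^bsub>matrix_ring_over n R\<^esub> A \<oplus>\<^bsub>matrix_ring_over n R\<^esub>
      diag_idem n {m} \<otimes>\<^bsub>matrix_ring_over n R\<^esub> A"
      using M.l_distr[OF diag_idem_carrier diag_idem_carrier A] by metis
    moreover have "diag_idem n {..<m} \<otimes>\<^bsub>matrix_ring_over n R\<^esub> A \<in> G"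
      "diag_idem n {m} \<otimes>\<^bsub>matrix_ring_over n R\<^esub> A \<in> G"
      using Suc row by simp_all
    ultimately show ?case using additive_subgroup.a_closed[OF G] by metis
  qed
  from this[OF order.refl] show ?thesis
    unfolding diag_idem_all M.l_one[OF A] .
qed

end

section \<open>Matrices over the Jacobson radical\<close>

context ring
begin

text \<open>\<open>jacobson_radical_map\<close> puts \<open>x\<close> at the diagonal position of
  its column \<open>j\<close>. Left multiplication by a matrix unit then moves it to row
  \<open>i\<close> within the radical.\<close>

lemma matrix_unit_jacobson:
  assumes j: "j < n" and i: "i < n" and x: "x \<in> jacobson_radical R"
  shows "matrix_unit n i j x \<in> jacobson_radical (matrix_ring_over n R)"
proof -
  let ?M = "matrix_ring_over n R"
  interpret M: ring ?M by (rule matrix_ring_over_is_ring)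
  have xR: "x \<in> carrier R" using x by (simp add: jacobson_radical_def)
  have jj: "matrix_unit n j j x \<in> jacobson_radical ?M"
  \<comment> \<open>The map \<open>matrix_unit n j j\<close> does not preserve the identity. Its
    image of \<open>\<one>\<close> serves as \<open>t\<close>: it fixes itself, and it cuts
    \<open>S\<close> times the image of \<open>r\<close>, which lives in column \<open>j\<close>,
    down to the image of \<open>S $$ (j, j) \<otimes> r\<close>.\<close>
  proof (rule jacobson_radical_map[OF ring_axioms M.ring_axioms _ _ _ _ _ _ x,
        where t = "matrix_unit n j j \<one>"])
    fix r assume "r \<in> carrier R"
    then show "matrix_unit n j j r \<in> carrier ?M" by (rule matrix_unit_carrier)
  next
    fix r s assume "r \<in> carrier R" "s \<in> carrier R"
    then show "matrix_unit n j j (r \<oplus> s) = matrix_unit n j j r \<oplus>\<^bsub>?M\<^esub> matrix_unit n j j s"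
      by (rule matrix_unit_add)
  next
    fix r s assume "r \<in> carrier R" "s \<in> carrier R"
    then show "\<exists>s'\<in>carrier ?M. matrix_unit n j j (s \<otimes> r) = s' \<otimes>\<^bsub>?M\<^esub> matrix_unit n j j r"
      using matrix_unit_mult_matrix_unit[OF _ _ j] matrix_unit_carrier by metis
  next
    show "matrix_unit n j j \<one> \<in> carrier ?M" by (rule matrix_unit_carrier[OF one_closed])
    show "matrix_unit n j j \<one> \<otimes>\<^bsub>?M\<^esub> matrix_unit n j j \<one> = matrix_unit n j j \<one>"
      using matrix_unit_mult_matrix_unit[OF one_closed one_closed j, of j j] by (metis l_one one_closed)
  next
    fix r S assume r: "r \<in> carrier R" and S: "S \<in> carrier ?M"
    then have SR: "S $$ (j, j) \<in> carrier R" using j by simp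
    have "S \<otimes>\<^bsub>?M\<^esub> matrix_unit n j j r = mat n n (\<lambda>(p, c). if c = j then S $$ (p, j) \<otimes> r else \<zero>)"
      by (rule mult_matrix_unit[OF S r j])
    moreover have "S \<otimes>\<^bsub>?M\<^esub> matrix_unit n j j r \<in> carrier ?M"
      using S matrix_unit_carrier[OF r] by (rule M.m_closed)
    ultimately have "matrix_unit n j j \<one> \<otimes>\<^bsub>?M\<^esub> (S \<otimes>\<^bsub>?M\<^esub> matrix_unit n j j r) =
        mat n n (\<lambda>(p, c). if p = j then \<one> \<otimes>
          mat n n (\<lambda>(p, c). if c = j then S $$ (p, j) \<otimes> r else \<zero>) $$ (j, c) else \<zero>)"
      using matrix_unit_mult[OF _ one_closed j] by metis
    also have "\<dots> = matrix_unit n j j (S $$ (j, j) \<otimes> r)"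
      using j r SR by (auto intro!: eq_matI simp: matrix_unit_def)
    finally show "\<exists>s'\<in>carrier R. matrix_unit n j j \<one> \<otimes>\<^bsub>?M\<^esub> (S \<otimes>\<^bsub>?M\<^esub> matrix_unit n j j r) =
        matrix_unit n j j (s' \<otimes> r)"
      using SR by blast
  qed
  have "matrix_unit n i j \<one> \<otimes>\<^bsub>?M\<^esub> matrix_unit n j j x \<in> jacobson_radical ?M"
    by (rule ideal.I_l_closed[OF M.jacobson_radical_ideal jj matrix_unit_carrier[OF one_closed]])
  then show ?thesis
    using matrix_unit_mult_matrix_unit[OF one_closed xR j, of i j] l_one[OF xR] by metis
qed

text \<open>A matrix is the sum of its entries placed at matrix units. The inclusion serves twice in
  the end: a matrix outside the radical has an entry outside the radical of \<open>R\<close>, and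
  nilpotency modulo such matrices is nilpotency modulo the radical.\<close>

lemma matrices_over_jacobson:
  "matrices_over n (jacobson_radical R) \<subseteq> jacobson_radical (matrix_ring_over n R)"
proof
  let ?M = "matrix_ring_over n R"
  interpret M: ring ?M by (rule matrix_ring_over_is_ring)
  have G: "additive_subgroup (jacobson_radical ?M) ?M"
    using M.jacobson_radical_ideal by (simp add: ideal_def)
  fix A assume A: "A \<in> matrices_over n (jacobson_radical R)"
  then have AM: "A \<in> carrier ?M" unfolding matrices_over_def by blast
  show "A \<in> jacobson_radical ?M"
  proof (rule additive_subgroup_columns[OF G AM], rule additive_subgroup_rows[OF G])
    fix j assume "j < n"
    show "A \<otimes>\<^bsub>?M\<^esub> diag_idem n {j} \<in> carrier ?M"
      using AM diag_idem_carrier by (rule M.m_closed)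
    fix i assume "i < n"
    have "matrix_unit n i j (A $$ (i, j)) \<in> jacobson_radical ?M"
      using A \<open>i < n\<close> \<open>j < n\<close> by (intro matrix_unit_jacobson) (auto simp: matrices_over_def)
    then show "diag_idem n {i} \<otimes>\<^bsub>?M\<^esub> (A \<otimes>\<^bsub>?M\<^esub> diag_idem n {j}) \<in> jacobson_radical ?M"
      using diag_idem_mult_diag_idem[OF AM] by metis
  qed
qed

text \<open>An entry of \<open>Z\<close> outside \<open>J\<close> must sit in a column, respectively
  row, with index in \<open>S\<close>, as all others vanish. A matrix unit carries it unchanged to
  an index \<open>l\<close> in the nonempty set \<open>T\<close>.\<close>

lemma diag_idem_linked:
  assumes J: "ideal J R" and T: "T \<subseteq> {..<n}" "T \<noteq> {}"
  shows "ideal.linked (matrices_over n J) (matrix_ring_over n R) (diag_idem n S) (diag_idem n T)"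
proof -
  let ?M = "matrix_ring_over n R"
  interpret J: ideal J R by fact
  interpret K: ideal "matrices_over n J" ?M by (rule matrices_over_ideal[OF J])
  have zero: "\<zero> \<in> J" by (rule additive_subgroup.zero_closed[OF J.additive_subgroup_axioms])
  obtain l where l: "l \<in> T" "l < n" using T by blast
  show ?thesis
    unfolding K.linked_def
  proof (intro conjI ballI impI)
    fix Z assume Z: "Z \<in> carrier ?M - matrices_over n J" and eq: "Z \<otimes>\<^bsub>?M\<^esub> diag_idem n S = Z"
    then have ZM: "Z \<in> carrier ?M" by blast
    from Z obtain r c where rc: "r < n" "c < n" "Z $$ (r, c) \<notin> J"
      unfolding matrices_over_def by blast
    have "c \<in> S"
    proof (rule ccontr)
      assume "c \<notin> S"
      then have "(Z \<otimes>\<^bsub>?M\<^esub> diag_idem n S) $$ (r, c) = \<zero>"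
        unfolding mult_diag_idem[OF ZM] using rc by simp
      with rc zero eq show False by metis
    qed
    then have "matrix_unit n c l \<one> \<in> K.corner (diag_idem n S) (diag_idem n T)"
      using rc l by (intro matrix_unit_corner) auto
    moreover have "(Z \<otimes>\<^bsub>?M\<^esub> matrix_unit n c l \<one>) $$ (r, l) = Z $$ (r, c)"
      unfolding mult_matrix_unit[OF ZM one_closed rc(2)] using rc l ZM by simp
    then have "Z \<otimes>\<^bsub>?M\<^esub> matrix_unit n c l \<one> \<notin> matrices_over n J"
      unfolding matrices_over_def mem_Collect_eq using rc l by metis
    ultimately show "\<exists>y\<in>K.corner (diag_idem n S) (diag_idem n T). Z \<otimes>\<^bsub>?M\<^esub> y \<notin> matrices_over n J"
      by blast
  next
    fix Z assume Z: "Z \<in> carrier ?M - matrices_over n J" and eq: "diag_idem n S \<otimes>\<^bsub>?M\<^esub> Z = Z"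
    then have ZM: "Z \<in> carrier ?M" by blast
    from Z obtain r c where rc: "r < n" "c < n" "Z $$ (r, c) \<notin> J"
      unfolding matrices_over_def by blast
    have "r \<in> S"
    proof (rule ccontr)
      assume "r \<notin> S"
      then have "(diag_idem n S \<otimes>\<^bsub>?M\<^esub> Z) $$ (r, c) = \<zero>"
        unfolding diag_idem_mult[OF ZM] using rc by simp
      with rc zero eq show False by metis
    qed
    then have "matrix_unit n l r \<one> \<in> K.corner (diag_idem n T) (diag_idem n S)"
      using rc l by (intro matrix_unit_corner) auto
    moreover have "(matrix_unit n l r \<one> \<otimes>\<^bsub>?M\<^esub> Z) $$ (l, c) = Z $$ (r, c)"
      unfolding matrix_unit_mult[OF ZM one_closed rc(1)] using rc l ZM by simp
    then have "matrix_unit n l r \<one> \<otimes>\<^bsub>?M\<^esub> Z \<notin> matrices_over n J"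
      unfolding matrices_over_def mem_Collect_eq using rc l by metis
    ultimately show "\<exists>x\<in>K.corner (diag_idem n T) (diag_idem n S). x \<otimes>\<^bsub>?M\<^esub> Z \<notin> matrices_over n J"
      by blast
  qed
qed

lemma matrix_unit_pow:
  assumes "a \<in> carrier R" "i < n" "m \<ge> 1"
  shows "matrix_unit n i i a [^]\<^bsub>matrix_ring_over n R\<^esub> (m::nat) = matrix_unit n i i (a [^] m)"
proof -
  interpret M: ring "matrix_ring_over n R" by (rule matrix_ring_over_is_ring)
  show ?thesis
    using assms(3)
  proof (induction m rule: nat_induct_at_least)
    case base
    have "matrix_unit n i i a [^]\<^bsub>matrix_ring_over n R\<^esub> (1::nat) = matrix_unit n i i a"
      using M.nat_pow_Suc[of _ 0] M.l_one[OF matrix_unit_carrier[OF assms(1)]] M.nat_pow_0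
      by (metis One_nat_def)
    then show ?case using assms(1) by simp
  next
    case (Suc m)
    then show ?case
      using matrix_unit_mult_matrix_unit[OF nat_pow_closed[OF assms(1), of m] assms(1,2), of i i]
      by (metis M.nat_pow_Suc nat_pow_Suc)
  qed
qed

text \<open>The base case: \<open>matrix_unit n i i\<close> identifies the corner with
  \<open>R\<close>, and the decomposition of the single entry is carried over along it.\<close>

lemma fine_corner_diag_idem_singleton:
  assumes fine: "generalized_sqrtJ_fine R" and i: "i < n"
  shows "ideal.fine_corner (matrices_over n (jacobson_radical R)) (matrix_ring_over n R)
    (diag_idem n {i})"
proof -
  let ?M = "matrix_ring_over n R" and ?J = "jacobson_radical R"
  interpret J: ideal ?J R by (rule jacobson_radical_ideal)
  interpret K: ideal "matrices_over n ?J" ?M by (rule matrices_over_ideal[OF J.ideal_axioms])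
  have zero: "\<zero> \<in> ?J" by (rule additive_subgroup.zero_closed[OF J.additive_subgroup_axioms])
  have K: "matrix_unit n i i a \<in> matrices_over n ?J" if "a \<in> ?J" for a
    using that zero J.a_Hcarr by (auto simp: matrices_over_def matrix_unit_def)
  note mm = matrix_unit_mult_matrix_unit[OF _ _ i, of _ _ i i]
  have cor: "matrix_unit n i i a \<in> K.corner (diag_idem n {i}) (diag_idem n {i})"
    if "a \<in> carrier R" for a
    using that i by (intro matrix_unit_corner) auto
  show ?thesis
    unfolding K.fine_corner_def
  proof
    fix A assume "A \<in> K.corner (diag_idem n {i}) (diag_idem n {i}) - matrices_over n ?J"
    then have A: "A \<in> K.corner (diag_idem n {i}) (diag_idem n {i})" "A \<notin> matrices_over n ?J" by auto
    define r where "r = A $$ (i, i)"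
    have AM: "A \<in> carrier ?M" using A(1) by (rule K.cornerD)
    have Ar: "A = matrix_unit n i i r"
      using diag_idem_mult_diag_idem[OF AM] K.cornerD(2,3)[OF A(1)] unfolding r_def by metis
    have "r \<in> carrier R" using AM i by (simp add: r_def)
    moreover have "r \<notin> ?J" using A(2) K unfolding Ar by blast
    ultimately obtain u a where u: "u \<in> Units R" and a: "a \<in> sqrt_jacobson R" and r: "r = u \<oplus> a"
      using fine unfolding generalized_sqrtJ_fine_def by blast
    from a obtain m :: nat where aR: "a \<in> carrier R" and m: "m \<ge> 1" "a [^] m \<in> ?J"
      by (auto simp: sqrt_jacobson_def)
    have uR: "u \<in> carrier R" "inv u \<in> carrier R" using u by auto
    have "matrix_unit n i i u \<otimes>\<^bsub>?M\<^esub> matrix_unit n i i (inv u) = diag_idem n {i}"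
      "matrix_unit n i i (inv u) \<otimes>\<^bsub>?M\<^esub> matrix_unit n i i u = diag_idem n {i}"
      unfolding mm[OF uR] mm[OF uR(2,1)] diag_idem_singleton using u by simp_all
    then have "K.corner_unit (diag_idem n {i}) (matrix_unit n i i u)"
      using cor uR unfolding K.corner_unit_def by blast
    moreover have "K.nilpotent_mod (matrix_unit n i i a)"
      unfolding K.nilpotent_mod_def
      using m K[OF m(2)] matrix_unit_pow[OF aR i] by metis
    moreover have "A = matrix_unit n i i u \<oplus>\<^bsub>?M\<^esub> matrix_unit n i i a"
      unfolding Ar r by (rule matrix_unit_add[OF uR(1) aR])
    ultimately show "K.fine_at (diag_idem n {i}) A"
      using cor aR unfolding K.fine_at_def by blast
  qed
qed

text \<open>Induction on the index set from singletons: the new index and the old set give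
  orthogonal idempotents, linked both ways because both sets are nonempty.\<close>

lemma fine_corner_diag_idem:
  assumes fine: "generalized_sqrtJ_fine R" and "finite S" "S \<noteq> {}" "S \<subseteq> {..<n}"
  shows "ideal.fine_corner (matrices_over n (jacobson_radical R)) (matrix_ring_over n R)
    (diag_idem n S)"
proof -
  let ?M = "matrix_ring_over n R" and ?J = "jacobson_radical R"
  interpret J: ideal ?J R by (rule jacobson_radical_ideal)
  interpret K: ideal "matrices_over n ?J" ?M by (rule matrices_over_ideal[OF J.ideal_axioms])
  show ?thesis
    using assms(2-)
  proof (induction S rule: finite_ne_induct)
    case (singleton i)
    then show ?case by (intro fine_corner_diag_idem_singleton[OF fine]) simp
  next
    case (insert i S)
    then have iS: "{i} \<inter> S = {}" "i < n" "S \<subseteq> {..<n}" by auto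
    have "K.fine_corner (diag_idem n {i} \<oplus>\<^bsub>?M\<^esub> diag_idem n S)"
      using insert iS
      by (intro K.fine_corner_sum diag_idem_orthogonal diag_idem_linked[OF J.ideal_axioms]
          fine_corner_diag_idem_singleton[OF fine]) auto
    then show ?case
      unfolding diag_idem_union[OF iS(1), symmetric] by simp
  qed
qed

end

theorem theorem3p6:
  fixes R :: "('a, 'm) ring_scheme" and n :: nat
  assumes "ring R"
    and "generalized_sqrtJ_fine R"
    and "n \<ge> 1"
  shows "generalized_sqrtJ_fine (matrix_ring_over n R)"
proof -
  let ?M = "matrix_ring_over n R" and ?K = "ring.matrices_over R n (jacobson_radical R)"
  interpret ring R by fact
  interpret K: ideal ?K ?M
    by (rule matrices_over_ideal[OF jacobson_radical_ideal])
  \<comment> \<open>Since \<open>n \<ge> 1\<close>, the full index set is nonempty, and its diagonal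
    idempotent is the identity matrix.\<close>
  have fine: "K.fine_corner \<one>\<^bsub>?M\<^esub>"
    using fine_corner_diag_idem[OF assms(2), of "{..<n}" n] assms(3) unfolding diag_idem_all
    by (simp add: lessThan_empty_iff)
  show ?thesis
    unfolding generalized_sqrtJ_fine_def
  proof
    fix A assume A: "A \<in> carrier ?M - jacobson_radical ?M"
    \<comment> \<open>The corner of the identity is the whole ring, and \<open>A\<close> cannot have
      all its entries in the radical of \<open>R\<close> without lying in the radical
      itself.\<close>
    then have "A \<in> K.corner \<one>\<^bsub>?M\<^esub> \<one>\<^bsub>?M\<^esub>" "A \<notin> ?K"
      using matrices_over_jacobson[of n] K.l_one K.r_one unfolding K.corner_def by blast+
    with fine obtain u a where u: "K.corner_unit \<one>\<^bsub>?M\<^esub> u"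
      and a: "a \<in> K.corner \<one>\<^bsub>?M\<^esub> \<one>\<^bsub>?M\<^esub>" "K.nilpotent_mod a" and eq: "A = u \<oplus>\<^bsub>?M\<^esub> a"
      unfolding K.fine_corner_def K.fine_at_def by blast
    have "u \<in> Units ?M"
      using u K.cornerD(1) unfolding K.corner_unit_def Units_def by blast
    moreover have "a \<in> sqrt_jacobson ?M"
      using a(2) K.cornerD(1)[OF a(1)] matrices_over_jacobson[of n]
      unfolding K.nilpotent_mod_def sqrt_jacobson_def by blast
    ultimately show "\<exists>u\<in>Units ?M. \<exists>a\<in>sqrt_jacobson ?M. A = u \<oplus>\<^bsub>?M\<^esub> a"
      using eq by blast
  qed
qed

end
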